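(* Let $h>0$, let $D\in\mathcal E$, and let $\psi:D^c\to U$ be a bounded measurable map satisfying $\psi(D^c)\subset D$. Let $\bar V=(\bar\sigma_i,\bar\xi_i)_{i=1}^\infty\in\mathbb V_h$ be given by $\bar\sigma_0\equiv0$ and, for $i\ge1$, $$\bar\sigma_i:=h\inf\{n\in\mathbb N:n\ge\bar\sigma_{i-1}/h,\ X^i_{nh}\notin D\},\qquad\bar\xi_i:=\psi(X^i_{\bar\sigma_i})1_{\{\bar\sigma_i<\infty\}}+\xi_0\,1_{\{\bar\sigma_i=\infty\}},$$ with $\xi_0\in U$ some fixed point. Let $w_{\bar V}:E\to\mathbb R$ (bounded measurable) and $\lambda_{\bar V}\in\mathbb R$ be a solution to the Poisson equation: for all $n\in\mathbb N$, $$w_{\bar V}(x)=\mathbb E_x\Bigl[\sum_{i=0}^{(\tau_D/h)\wedge n-1}(g(X_{ih})-\lambda_{\bar V})+w_{\bar V}(X_{(nh)\wedge\tau_D})\Bigr],\quad x\in E,$$ $$w_{\bar V}(x)=\tfrac1hc(x,\psi(x))+w_{\bar V}(\psi(x)),\quad x\notin D,$$ where $\tau_D:=h\inf\{n\in\mathbb N:X_{nh}\notin D\}$. Then $$J^d_h(x,\bar V)=\lambda_{\bar V}=J_h(x,\bar V),\qquad x\in E.$$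
   Context: Conventions: $\mathbb N=\{0,1,2,\dots\}$, $\inf\emptyset:=\infty$, $\sum_{i=0}^{-1}(\cdot):=0$; $\mathcal C_b(E)$ is the space of bounded continuous real functions on $E$. Process. $X=(X_t)_{t\ge0}$ is a continuous-time standard Feller–Markov process on a filtered space $(\Omega,\mathcal F,(\mathcal F_t))$ (standard in the usual sense of Markov process theory) with values in a locally compact separable metric space $E$ with Borel $\sigma$-field $\mathcal E$; $\mathbb P_x,\mathbb E_x$ are the law and expectation for the process started at $x\in E$, and $P_t(x,A):=\mathbb P_x[X_t\in A]$. The set $U\subset E$ of admissible after-impulse states is a (nonempty) compact set. Standing assumptions. (1) $\beta:[0,\infty)\to(0,1]$ is weakly decreasing and continuous, $\beta(0)=1$, $\beta(t+s)\ge\beta(t)\beta(s)$ for all $t,s\ge0$, and $\int_0^\infty\beta(s)ds=\infty$. (2) $g:E\to\mathbb R$ is continuous and bounded; $c:E\times U\to\mathbb R_+$ is continuous and bounded, and for some $c_0>0$ we have $0<c_0\le c(x,\xi)\le c(x,\eta)+c(\eta,\xi)$ for $x\in E$, $\xi,\eta\in U$. (3) For every $f\in\mathcal C_b(E)$ and $t>0$, the map $x\mapsto\mathbb E_x[f(X_t)]$ is in $\mathcal C_b(E)$. (4) For every $t>0$ there is $\Lambda_t\in(0,1)$ with $\sup_{x,y\in E}\sup_{A\in\mathcal E}|P_t(x,A)-P_t(y,A)|\le\Lambda_t$. Impulse control. A strategy is a sequence $V=(\tau_i,\xi_i)_{i=1}^\infty$ with $(\tau_i)$ an increasing (weakly,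 values in $[0,\infty]$) sequence of stopping times and $\xi_i$ $\mathcal F_{\tau_i}$-measurable $U$-valued random variables. On a countable product of copies of $(\Omega,\mathcal F,(\mathcal F_t))$ with coordinate process $(X^1_t,X^2_t,\dots)$, to each $x\in E$ and $V$ one associates a probability $\mathbb P^V_x$ (expectation $\mathbb E^V_x$) under which $X^1$ follows the uncontrolled dynamics from $x$ and, for each $i\ge1$, on $\{\tau_i<\infty\}$, $X^{i+1}_{\tau_i}=\xi_i$ and from time $\tau_i$ on $X^{i+1}$ follows the uncontrolled dynamics started afresh from $\xi_i$ (conditionally on the past). The controlled process is $Y_t:=X^i_t$ for $t\in[\tau_{i-1},\tau_i)$, $\tau_0\equiv0$. $\mathbb V$ is the family of all strategies; $\mathbb V_h\subset\mathbb V$ those with impulse times restricted to $\{0,h,2h,\dots\}$ (or $\infty$, i.e. no impulse). Functionals. With $\varphi_h(i):=\frac1h\int_{ih}^{(i+1)h}\beta(s)ds$, $i\in\mathbb N$, for $x\in E$ and $V\in\mathbb V_h$, $$J^d_h(x,V):=\limsup_{n\to\infty}\frac{\mathbb E^V_x\bigl[\sum_{i=0}^{n-1}\varphi_h(i)g(Y_{ih})+\sum_{i=1}^\infty1_{\{\tau_i\le nh\}}\frac1h\varphi_h(\tau_i/h)c(X^i_{\tau_i},X^{i+1}_{\tau_i})\bigr]}{\sum_{i=0}^{n-1}\varphi_h(i)},$$ $$J_h(x,V):=\limsup_{n\to\infty}\frac1n\mathbb E^V_x\Bigl[\sum_{i=1}^{n}g(Y_{ih})+\sum_{i=1}^\infty1_{\{\tau_i\le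 nh\}}\tfrac1h c(X^i_{\tau_i},X^{i+1}_{\tau_i})\Bigr].$$ *)

theory Defs
  imports "HOL-Probability.Probability"
begin

section \<open>Standard processes\<close>

text \<open>
  The filtration is indexed by times in \<open>[0, \<infinity>]\<close>, so that the library's \<^const>\<open>stopping_time\<close> and
  \<open>filtration.pre_sigma\<close> apply to stopping times with values in \<open>[0, \<infinity>]\<close>; \<open>F \<infinity>\<close> plays the role of
  the whole \<open>\<sigma>\<close>-field of the sample space. The process \<open>X t\<close> only matters for real times \<open>t \<ge> 0\<close>.

  The assumptions are those of a standard process (Blumenthal and Getoor) with infinite lifetime:
  the usual conditions on the filtration, right-continuous paths with left limits, normality, the
  strong Markov property and quasi-left-continuity. Completeness is relative to the family of all
  laws \<open>\<integral> P x \<partial>\<mu>\<close>; that such a law does not charge a set says that the set is \<open>P x\<close>-null for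
  \<open>\<mu>\<close>-almost every \<open>x\<close>. The simple Markov property is the strong one at constant times.
\<close>

locale standard_process =
  fixes F :: "ennreal \<Rightarrow> 'w measure"
    and X :: "real \<Rightarrow> 'w \<Rightarrow> 'e::{metric_space, second_countable_topology}"
    and P :: "'e \<Rightarrow> 'w measure"
  assumes locally_compact: "locally compact (UNIV :: 'e set)"
    and filtration_F: "filtration (space (F \<infinity>)) F"
    and right_continuous_F: "\<And>t. t < \<infinity> \<Longrightarrow> sets (F t) = (\<Inter>s\<in>{t<..}. sets (F s))"
    and complete_F: "\<And>t A. A \<in> sets (F \<infinity>) \<Longrightarrow>
      (\<And>\<mu>. prob_space \<mu> \<Longrightarrow> sets \<mu> = sets (borel :: 'e measure) \<Longrightarrow>
         \<exists>B\<in>sets (F t). AE x in \<mu>. emeasure (P x) ((A - B) \<union> (B - A)) = 0) \<Longrightarrow>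
      A \<in> sets (F t)"
    and prob_space_P: "\<And>x. prob_space (P x)"
    and sets_P: "\<And>x. sets (P x) = sets (F \<infinity>)"
    and adapted: "\<And>t. 0 \<le> t \<Longrightarrow> X t \<in> borel_measurable (F (ennreal t))"
    and measurable_kernel: "\<And>t A. 0 \<le> t \<Longrightarrow> A \<in> sets borel \<Longrightarrow>
      (\<lambda>x. emeasure (P x) {\<omega>\<in>space (F \<infinity>). X t \<omega> \<in> A}) \<in> borel_measurable borel"
    and start: "\<And>x. AE \<omega> in P x. X 0 \<omega> = x"
    and right_continuous_paths: "\<And>\<omega> t. \<omega> \<in> space (F \<infinity>) \<Longrightarrow> 0 \<le> t \<Longrightarrow>
      ((\<lambda>s. X s \<omega>) \<longlongrightarrow> X t \<omega>) (at_right t)"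
    and left_limits: "\<And>x. AE \<omega> in P x. \<forall>t>0. \<exists>l. ((\<lambda>s. X s \<omega>) \<longlongrightarrow> l) (at_left t)"
    and strong_Markov: "\<And>x \<tau> A t B. stopping_time F \<tau> \<Longrightarrow>
      A \<in> sets (filtration.pre_sigma (space (F \<infinity>)) F \<tau>) \<Longrightarrow> 0 \<le> t \<Longrightarrow> B \<in> sets borel \<Longrightarrow>
      emeasure (P x) {\<omega>\<in>A. \<tau> \<omega> < \<infinity> \<and> X (enn2real (\<tau> \<omega>) + t) \<omega> \<in> B} =
      (\<integral>\<^sup>+\<omega>\<in>{\<omega>\<in>A. \<tau> \<omega> < \<infinity>}.
         emeasure (P (X (enn2real (\<tau> \<omega>)) \<omega>)) {\<omega>'\<in>space (F \<infinity>). X t \<omega>' \<in> B} \<partial>P x)"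
    and quasi_left_continuous: "\<And>x (\<tau> :: nat \<Rightarrow> 'w \<Rightarrow> ennreal). (\<And>n. stopping_time F (\<tau> n)) \<Longrightarrow>
      (\<And>\<omega>. \<omega> \<in> space (F \<infinity>) \<Longrightarrow> incseq (\<lambda>n. \<tau> n \<omega>)) \<Longrightarrow>
      (AE \<omega> in P x. (SUP n. \<tau> n \<omega>) < \<infinity> \<longrightarrow>
         (\<lambda>n. X (enn2real (\<tau> n \<omega>)) \<omega>) \<longlonglongrightarrow> X (enn2real (SUP n. \<tau> n \<omega>)) \<omega>)"

section \<open>Impulse strategies and the controlled process\<close>

text \<open>
  A point of the product space is a sequence \<open>\<omega>\<close> indexed by \<open>1, 2, \<dots>\<close>; the coordinate process
  \<open>X\<^sup>i\<close> at time \<open>t\<close> is \<open>X t (\<omega> i)\<close>.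
\<close>

definition copies :: "(ennreal \<Rightarrow> 'w measure) \<Rightarrow> (nat \<Rightarrow> 'w) measure" where
  "copies F = (\<Pi>\<^sub>M i\<in>{1..}. F \<infinity>)"

text \<open>
  The information carried at time \<open>t\<close> by the first \<open>i\<close> copies. The \<open>i\<close>-th impulse is decided on the
  basis of these, as the copy \<open>i + 1\<close> only comes into play after it.
\<close>

definition copies_filtration ::
    "(ennreal \<Rightarrow> 'w measure) \<Rightarrow> nat \<Rightarrow> ennreal \<Rightarrow> (nat \<Rightarrow> 'w) measure" where
  "copies_filtration F i t =
     vimage_algebra (space (copies F)) (\<lambda>\<omega>. restrict \<omega> {1..i}) (\<Pi>\<^sub>M j\<in>{1..i}. F t)"

definition past_at ::
    "(ennreal \<Rightarrow> 'w measure) \<Rightarrow> nat \<Rightarrow> ((nat \<Rightarrow> 'w) \<Rightarrow> ennreal) \<Rightarrow> (nat \<Rightarrow> 'w) measure" where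
  "past_at F i \<tau> = filtration.pre_sigma (space (copies F)) (copies_filtration F i) \<tau>"

text \<open>
  A strategy is a pair \<open>(\<tau>, \<xi>)\<close> of sequences. The impulses are numbered from \<open>1\<close>; \<open>\<tau> 0\<close> is \<open>0\<close> by
  convention and \<open>\<xi> 0\<close> is not used.
\<close>

type_synonym ('w, 'e) strategy =
  "(nat \<Rightarrow> (nat \<Rightarrow> 'w) \<Rightarrow> ennreal) \<times> (nat \<Rightarrow> (nat \<Rightarrow> 'w) \<Rightarrow> 'e)"

definition strategies ::
    "(ennreal \<Rightarrow> 'w measure) \<Rightarrow> 'e::topological_space set \<Rightarrow> ('w, 'e) strategy set" where
  "strategies F U = {(\<tau>, \<xi>).
     (\<forall>\<omega>\<in>space (copies F). \<tau> 0 \<omega> = 0) \<and>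
     (\<forall>i\<ge>1.
        stopping_time (copies_filtration F i) (\<tau> i) \<and>
        (\<forall>\<omega>\<in>space (copies F). \<tau> (i - 1) \<omega> \<le> \<tau> i \<omega>) \<and>
        \<xi> i \<in> borel_measurable (past_at F i (\<tau> i)) \<and>
        (\<forall>\<omega>\<in>space (copies F). \<xi> i \<omega> \<in> U))}"

definition grid_strategies ::
    "(ennreal \<Rightarrow> 'w measure) \<Rightarrow> 'e::topological_space set \<Rightarrow> real \<Rightarrow> ('w, 'e) strategy set" where
  "grid_strategies F U h = {(\<tau>, \<xi>) \<in> strategies F U.
     \<forall>i\<ge>1. \<forall>\<omega>\<in>space (copies F). \<tau> i \<omega> = \<infinity> \<or> (\<exists>n::nat. \<tau> i \<omega> = ennreal (real n * h))}"

definition path_from :: "(real \<Rightarrow> 'w \<Rightarrow> 'e) \<Rightarrow> real \<Rightarrow> 'w \<Rightarrow> real \<Rightarrow> 'e" where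
  "path_from X s \<omega> = (\<lambda>t\<in>{0..}. X (s + t) \<omega>)"

text \<open>
  \<open>M\<close> is a law of the controlled system: \<open>X\<^sup>1\<close> has the path law of \<open>X\<close> under \<open>P x\<close>; on
  \<open>\<tau>\<^sub>i < \<infinity>\<close>, the copy \<open>i + 1\<close> is at \<open>\<xi>\<^sub>i\<close> at time \<open>\<tau>\<^sub>i\<close> and, conditionally on the past at \<open>\<tau>\<^sub>i\<close>, its
  path from \<open>\<tau>\<^sub>i\<close> on has the path law of \<open>X\<close> under \<open>P \<xi>\<^sub>i\<close>. Nothing is required of the copy \<open>i + 1\<close>
  before \<open>\<tau>\<^sub>i\<close>, as the controlled process does not see it.
\<close>

definition controlled_law ::
    "(ennreal \<Rightarrow> 'w measure) \<Rightarrow> (real \<Rightarrow> 'w \<Rightarrow> 'e::topological_space) \<Rightarrow> ('e \<Rightarrow> 'w measure) \<Rightarrow>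
     'e \<Rightarrow> ('w, 'e) strategy \<Rightarrow> (nat \<Rightarrow> 'w) measure \<Rightarrow> bool" where
  "controlled_law F X P x V M \<longleftrightarrow> (case V of (\<tau>, \<xi>) \<Rightarrow>
     prob_space M \<and> sets M = sets (copies F) \<and>
     (\<forall>C\<in>sets (\<Pi>\<^sub>M t\<in>{0..}. borel).
        emeasure M {\<omega>\<in>space (copies F). path_from X 0 (\<omega> 1) \<in> C} =
        emeasure (P x) {\<omega>\<in>space (F \<infinity>). path_from X 0 \<omega> \<in> C}) \<and>
     (\<forall>i\<ge>1.
        (AE \<omega> in M. \<tau> i \<omega> < \<infinity> \<longrightarrow> X (enn2real (\<tau> i \<omega>)) (\<omega> (i + 1)) = \<xi> i \<omega>) \<and>
        (\<forall>A\<in>sets (past_at F i (\<tau> i)). \<forall>C\<in>sets (\<Pi>\<^sub>M t\<in>{0..}. borel).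
           emeasure M {\<omega>\<in>A. \<tau> i \<omega> < \<infinity> \<and> path_from X (enn2real (\<tau> i \<omega>)) (\<omega> (i + 1)) \<in> C} =
           (\<integral>\<^sup>+\<omega>\<in>{\<omega>\<in>A. \<tau> i \<omega> < \<infinity>}.
              emeasure (P (\<xi> i \<omega>)) {\<omega>'\<in>space (F \<infinity>). path_from X 0 \<omega>' \<in> C} \<partial>M))))"

text \<open>The value is irrelevant at times beyond all the impulse times (if they accumulate).\<close>

definition controlled_process ::
    "(real \<Rightarrow> 'w \<Rightarrow> 'e) \<Rightarrow> ('w, 'e) strategy \<Rightarrow> real \<Rightarrow> (nat \<Rightarrow> 'w) \<Rightarrow> 'e" where
  "controlled_process X V t \<omega> = (case V of (\<tau>, \<xi>) \<Rightarrow>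
     X t (\<omega> (THE i. 1 \<le> i \<and> \<tau> (i - 1) \<omega> \<le> ennreal t \<and> ennreal t < \<tau> i \<omega>)))"

section \<open>Cost functionals\<close>

definition discount_weight :: "(real \<Rightarrow> real) \<Rightarrow> real \<Rightarrow> nat \<Rightarrow> real" where
  "discount_weight \<beta> h i = 1 / h * integral {real i * h .. (real i + 1) * h} \<beta>"

text \<open>
  The impulse costs up to time \<open>n h\<close>, the one at time \<open>k h\<close> being weighted by \<open>a k\<close>. For a strategy on
  the grid \<open>\<tau>\<^sub>i / h\<close> is a natural number, so that rounding down only converts the type.
\<close>

definition impulse_costs ::
    "(real \<Rightarrow> 'w \<Rightarrow> 'e) \<Rightarrow> ('e \<Rightarrow> 'e \<Rightarrow> real) \<Rightarrow> real \<Rightarrow> (nat \<Rightarrow> real) \<Rightarrow>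
     ('w, 'e) strategy \<Rightarrow> nat \<Rightarrow> (nat \<Rightarrow> 'w) \<Rightarrow> ennreal" where
  "impulse_costs X c h a V n \<omega> = (case V of (\<tau>, \<xi>) \<Rightarrow>
     \<Sum>k. let i = Suc k; s = enn2real (\<tau> i \<omega>) in
       if \<tau> i \<omega> \<le> ennreal (real n * h)
       then ennreal (1 / h * a (nat \<lfloor>s / h\<rfloor>) * c (X s (\<omega> i)) (X s (\<omega> (i + 1))))
       else 0)"

text \<open>
  \<open>Q x V\<close> is the law under control. The running part is bounded, and the impulse costs are
  nonnegative with a possibly infinite expectation; the expectation of the sum is therefore written
  as the sum of the expectations, in the extended reals.
\<close>

definition J_disc ::
    "(real \<Rightarrow> 'w \<Rightarrow> 'e) \<Rightarrow> ('e \<Rightarrow> ('w, 'e) strategy \<Rightarrow> (nat \<Rightarrow> 'w) measure) \<Rightarrow> (real \<Rightarrow> real) \<Rightarrow>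
     ('e \<Rightarrow> real) \<Rightarrow> ('e \<Rightarrow> 'e \<Rightarrow> real) \<Rightarrow> real \<Rightarrow> 'e \<Rightarrow> ('w, 'e) strategy \<Rightarrow> ereal" where
  "J_disc X Q \<beta> g c h x V = limsup (\<lambda>n.
     (ereal (\<integral>\<omega>. (\<Sum>i<n. discount_weight \<beta> h i * g (controlled_process X V (real i * h) \<omega>)) \<partial>Q x V)
      + enn2ereal (\<integral>\<^sup>+\<omega>. impulse_costs X c h (discount_weight \<beta> h) V n \<omega> \<partial>Q x V))
     / ereal (\<Sum>i<n. discount_weight \<beta> h i))"

definition J_avg ::
    "(real \<Rightarrow> 'w \<Rightarrow> 'e) \<Rightarrow> ('e \<Rightarrow> ('w, 'e) strategy \<Rightarrow> (nat \<Rightarrow> 'w) measure) \<Rightarrow>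
     ('e \<Rightarrow> real) \<Rightarrow> ('e \<Rightarrow> 'e \<Rightarrow> real) \<Rightarrow> real \<Rightarrow> 'e \<Rightarrow> ('w, 'e) strategy \<Rightarrow> ereal" where
  "J_avg X Q g c h x V = limsup (\<lambda>n.
     (ereal (\<integral>\<omega>. (\<Sum>i=1..n. g (controlled_process X V (real i * h) \<omega>)) \<partial>Q x V)
      + enn2ereal (\<integral>\<^sup>+\<omega>. impulse_costs X c h (\<lambda>_. 1) V n \<omega> \<partial>Q x V))
     / ereal (real n))"

section \<open>The strategy induced by a continuation set and an impulse map\<close>

text \<open>
  The first time on the grid, not before \<open>s\<close>, at which the path is outside \<open>D\<close>; the infimum of the
  empty set is \<open>\<infinity>\<close>.
\<close>

definition exit_time_from ::
    "(real \<Rightarrow> 'w \<Rightarrow> 'e) \<Rightarrow> real \<Rightarrow> 'e set \<Rightarrow> ennreal \<Rightarrow> 'w \<Rightarrow> ennreal" where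
  "exit_time_from X h D s \<omega> =
     (INF n\<in>{n::nat. s \<le> ennreal (real n * h) \<and> X (real n * h) \<omega> \<notin> D}. ennreal (real n * h))"

definition exit_time :: "(real \<Rightarrow> 'w \<Rightarrow> 'e) \<Rightarrow> real \<Rightarrow> 'e set \<Rightarrow> 'w \<Rightarrow> ennreal" where
  "exit_time X h D = exit_time_from X h D 0"

primrec impulse_times ::
    "(real \<Rightarrow> 'w \<Rightarrow> 'e) \<Rightarrow> real \<Rightarrow> 'e set \<Rightarrow> nat \<Rightarrow> (nat \<Rightarrow> 'w) \<Rightarrow> ennreal" where
  "impulse_times X h D 0 \<omega> = 0"
| "impulse_times X h D (Suc i) \<omega> = exit_time_from X h D (impulse_times X h D i \<omega>) (\<omega> (Suc i))"

definition induced_strategy ::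
    "(real \<Rightarrow> 'w \<Rightarrow> 'e) \<Rightarrow> real \<Rightarrow> 'e set \<Rightarrow> ('e \<Rightarrow> 'e) \<Rightarrow> 'e \<Rightarrow> ('w, 'e) strategy" where
  "induced_strategy X h D \<psi> \<xi>\<^sub>0 =
     (impulse_times X h D,
      \<lambda>i \<omega>. if impulse_times X h D i \<omega> < \<infinity>
            then \<psi> (X (enn2real (impulse_times X h D i \<omega>)) (\<omega> i)) else \<xi>\<^sub>0)"

end

theory Submission
  imports Defs
begin

text \<open>
  Observe the controlled process at the grid times only. Just before a possible impulse at time
  \<open>n * h\<close> it is at \<open>Z n\<close>, just after at \<open>Y n\<close>: if \<open>Z n\<close> is in \<open>D\<close>, then \<open>Y n = Z n\<close>; otherwise an impulse
  is made and \<open>Y n = \<psi> (Z n)\<close>, which is in \<open>D\<close> again. So \<open>Y n\<close> is always in \<open>D\<close>, there is at most one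
  impulse per grid time, and \<open>Z (n + 1)\<close> arises from \<open>Y n\<close> by one step of the uncontrolled chain.

  For a start in \<open>D\<close> the Poisson equation with \<open>n = 1\<close> reads \<open>w y = g y - lam + E\<^sub>y (w (X h))\<close>; outside
  \<open>D\<close> the second equation says that \<open>w\<close> drops by exactly the scaled impulse cost at an impulse. Taking
  expectations, with \<open>a n\<close> the mean of \<open>g (Y n)\<close>, \<open>b n\<close> the mean scaled impulse cost at time \<open>n * h\<close> and
  \<open>u n\<close> the mean of \<open>w (Y n)\<close>, it follows that \<open>a n + b (n + 1) = lam + u n - u (n + 1)\<close>
  (\<open>mean_balance\<close>). All three sequences are bounded. When this is summed with constant weights, the
  differences of \<open>u\<close> telescope and the average cost tends to \<open>lam\<close>. With decreasing weights whose sum diverges,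
  summation by parts leaves a bounded error, both for the potential terms and for the mismatch between
  the weights of \<open>a n\<close> and \<open>b (n + 1)\<close>, so that the weighted average has the same limit
  (\<open>weighted_average_of_balanced\<close>). The discount weights are decreasing and have a divergent sum.

  The remaining work is to derive the one-step dynamics of \<open>Y\<close> and \<open>Z\<close> from the law of the countably
  many copies. Copy \<open>i + 1\<close> is tied to the past only at the random time at which it comes into use, and
  its whole path from then on is described. Fix this time and the number of grid steps since
  then: the event that the copy is still in use says that its path has been in \<open>D\<close> so far, and the law
  of the path until it leaves \<open>D\<close> is given by the powers of a killed transition operator
  (\<open>killed_path_expectation\<close>, \<open>copy_law\<close>). Comparing two successive powers gives the Markov property on
  that event (\<open>copy_Markov\<close>), and these events for all copies and activation times exhaust the sample
  space up to a null set (\<open>indicator_on_copy\<close>, \<open>Markov_between_impulses\<close>).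
\<close>

section \<open>Weighted averages of a balanced sequence\<close>

text \<open>
  Write the impulse cost with weight \<open>\<phi> (Suc i)\<close> as the one with weight \<open>\<phi> i\<close> minus
  \<open>(\<phi> i - \<phi> (Suc i)) * b (Suc i)\<close>. The balance then turns the numerator into \<open>lam\<close> times the
  denominator, plus \<open>\<Sum> \<phi> i * (u i - u (Suc i))\<close>, minus the sum of these differences, up to the term
  with \<open>b 0\<close>. Summation by parts writes both errors with the increments of \<open>\<phi>\<close>, whose sum
  telescopes, so that they stay bounded while the denominator diverges.
\<close>

lemma weighted_average_of_balanced:
  fixes \<phi> a b u :: "nat \<Rightarrow> real"
  assumes dec: "\<And>i. \<phi> (Suc i) \<le> \<phi> i"
    and nonneg: "\<And>i. 0 \<le> \<phi> i"
    and divergent: "filterlim (\<lambda>n. \<Sum>i<n. \<phi> i) at_top sequentially"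
    and balance: "\<And>i. a i + b (Suc i) = lam + u i - u (Suc i)"
    and u: "\<And>i. \<bar>u i\<bar> \<le> K"
    and b: "\<And>i. \<bar>b i\<bar> \<le> B"
  shows "(\<lambda>n. ((\<Sum>i<n. \<phi> i * a i) + (\<Sum>i\<le>n. \<phi> i * b i)) / (\<Sum>i<n. \<phi> i)) \<longlonglongrightarrow> lam"
proof -
  define S where "S n = (\<Sum>i<n. \<phi> i)" for n
  define R where "R n = (\<Sum>i<n. \<phi> i * a i) + (\<Sum>i\<le>n. \<phi> i * b i) - lam * S n" for n
  have eq: "R n = \<phi> 0 * (u 0 + b 0) - \<phi> n * u n
      - (\<Sum>i<n. (\<phi> i - \<phi> (Suc i)) * (u (Suc i) + b (Suc i)))" for n
  proof (induction n)
    case 0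
    show ?case by (simp add: R_def S_def algebra_simps)
  next
    case (Suc n)
    have a: "a n = lam + u n - u (Suc n) - b (Suc n)"
      using balance[of n] by simp
    have "R (Suc n) = R n + \<phi> n * a n + \<phi> (Suc n) * b (Suc n) - lam * \<phi> n"
      by (simp add: R_def S_def algebra_simps)
    then show ?case
      unfolding Suc.IH a by (simp add: algebra_simps)
  qed
  have le0: "\<phi> i \<le> \<phi> 0" for i
    by (rule lift_Suc_antimono_le[where f = \<phi>, OF dec]) simp
  have telescope: "(\<Sum>i<n. \<phi> i - \<phi> (Suc i)) = \<phi> 0 - \<phi> n" for n
    by (induction n) auto
  have ub: "\<bar>u i + b i\<bar> \<le> K + B" for i
    using u[of i] b[of i] by linarith
  have KB: "0 \<le> K" "0 \<le> B"
    using u[of 0] b[of 0] by auto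
  have bound: "\<bar>R n\<bar> \<le> 3 * \<phi> 0 * (K + B)" for n
  proof -
    have "\<bar>\<phi> 0 * (u 0 + b 0)\<bar> \<le> \<phi> 0 * (K + B)"
      unfolding abs_mult using nonneg ub[of 0] by (intro mult_mono) auto
    moreover have "\<bar>\<phi> n * u n\<bar> \<le> \<phi> 0 * (K + B)"
      unfolding abs_mult using nonneg le0 u[of n] KB by (intro mult_mono) auto
    moreover have "\<bar>\<Sum>i<n. (\<phi> i - \<phi> (Suc i)) * (u (Suc i) + b (Suc i))\<bar> \<le> \<phi> 0 * (K + B)"
    proof -
      have "\<bar>\<Sum>i<n. (\<phi> i - \<phi> (Suc i)) * (u (Suc i) + b (Suc i))\<bar>
          \<le> (\<Sum>i<n. \<bar>(\<phi> i - \<phi> (Suc i)) * (u (Suc i) + b (Suc i))\<bar>)"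
        by (rule sum_abs)
      also have "\<dots> \<le> (\<Sum>i<n. (\<phi> i - \<phi> (Suc i)) * (K + B))"
        unfolding abs_mult using dec ub by (intro sum_mono mult_mono) auto
      also have "\<dots> = (\<phi> 0 - \<phi> n) * (K + B)"
        by (simp add: telescope flip: sum_distrib_right)
      also have "\<dots> \<le> \<phi> 0 * (K + B)"
        using nonneg[of n] KB by (intro mult_right_mono) auto
      finally show ?thesis .
    qed
    ultimately show ?thesis
      unfolding eq by linarith
  qed
  have S_nonneg: "0 \<le> S n" for n
    unfolding S_def by (intro sum_nonneg nonneg)
  have "(\<lambda>n. R n / S n) \<longlonglongrightarrow> 0"
  proof (rule Lim_null_comparison)
    show "\<forall>\<^sub>F n in sequentially. norm (R n / S n) \<le> 3 * \<phi> 0 * (K + B) / S n"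
      using bound S_nonneg by (auto intro!: always_eventually divide_right_mono)
    show "(\<lambda>n. 3 * \<phi> 0 * (K + B) / S n) \<longlonglongrightarrow> 0"
      unfolding S_def by (rule real_tendsto_divide_at_top[OF tendsto_const divergent])
  qed
  then have "(\<lambda>n. lam + R n / S n) \<longlonglongrightarrow> lam + 0"
    by (intro tendsto_intros)
  moreover have "\<forall>\<^sub>F n in sequentially. 0 < S n"
    using divergent unfolding S_def filterlim_at_top_dense by auto
  then have "\<forall>\<^sub>F n in sequentially. lam + R n / S n =
      ((\<Sum>i<n. \<phi> i * a i) + (\<Sum>i\<le>n. \<phi> i * b i)) / (\<Sum>i<n. \<phi> i)"
    by eventually_elim (auto simp: R_def S_def field_simps)
  ultimately show ?thesis
    by (simp add: tendsto_cong)
qed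

section \<open>Discount weights\<close>

context
  fixes \<beta> :: "real \<Rightarrow> real" and h :: real
  assumes range: "\<And>t. 0 \<le> t \<Longrightarrow> 0 < \<beta> t \<and> \<beta> t \<le> 1"
    and decreasing: "\<And>s t. 0 \<le> s \<Longrightarrow> s \<le> t \<Longrightarrow> \<beta> t \<le> \<beta> s"
    and continuous: "continuous_on {0..} \<beta>"
    and h: "0 < h"
begin

lemma integrable_on_step: "\<beta> integrable_on {real i * h..(real i + 1) * h}"
  using h by (intro integrable_continuous_real continuous_on_subset[OF continuous]) auto

text \<open>
  Squeezing the mean of \<open>\<beta>\<close> over a step between the values of \<open>\<beta>\<close> at the end points of the step is
  what makes the weights monotone: consecutive steps share an end point.
\<close>

lemma discount_weight_bounds:
  shows "discount_weight \<beta> h i \<le> \<beta> (real i * h)"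
    and "\<beta> (real (Suc i) * h) \<le> discount_weight \<beta> h i"
proof -
  have len: "(real i + 1) * h - real i * h = h"
    by (simp add: algebra_simps)
  have le: "real i * h \<le> (real i + 1) * h"
    using h by simp
  have "integral {real i * h..(real i + 1) * h} \<beta> \<le> integral {real i * h..(real i + 1) * h} (\<lambda>_. \<beta> (real i * h))"
    using h by (intro integral_le integrable_on_step integrable_const_ivl decreasing) auto
  also have "\<dots> = h * \<beta> (real i * h)"
    using le len by simp
  finally show "discount_weight \<beta> h i \<le> \<beta> (real i * h)"
    using h by (simp add: discount_weight_def field_simps)
  have "h * \<beta> (real (Suc i) * h) = integral {real i * h..(real i + 1) * h} (\<lambda>_. \<beta> (real (Suc i) * h))"
    using le len by simp
  also have "\<dots> \<le> integral {real i * h..(real i + 1) * h} \<beta>"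
  proof (intro integral_le integrable_on_step integrable_const_ivl decreasing)
    fix t assume t: "t \<in> {real i * h..(real i + 1) * h}"
    moreover have "0 \<le> real i * h"
      using h by simp
    ultimately show "0 \<le> t" by auto
    show "t \<le> real (Suc i) * h"
      using t by (simp add: algebra_simps)
  qed
  finally show "\<beta> (real (Suc i) * h) \<le> discount_weight \<beta> h i"
    using h by (simp add: discount_weight_def field_simps)
qed

lemma discount_weight_pos: "0 < discount_weight \<beta> h i"
  using discount_weight_bounds(2)[of i] range[of "real (Suc i) * h"] h by (simp add: less_le_trans)

lemma discount_weight_decreasing: "discount_weight \<beta> h (Suc i) \<le> discount_weight \<beta> h i"
  using discount_weight_bounds(1)[of "Suc i"] discount_weight_bounds(2)[of i] by simp

lemma discount_weights_divergent:
  assumes "(\<integral>\<^sup>+s\<in>{0..}. ennreal (\<beta> s) \<partial>lborel) = \<infinity>"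
  shows "filterlim (\<lambda>n. \<Sum>i<n. discount_weight \<beta> h i) at_top sequentially"
proof -
  have step: "(\<integral>\<^sup>+s. indicator {real i * h..(real i + 1) * h} s * ennreal (\<beta> s) \<partial>lborel)
      = ennreal (h * discount_weight \<beta> h i)" for i
  proof -
    have nn: "0 \<le> \<beta> s" if "s \<in> {real i * h..(real i + 1) * h}" for s
    proof -
      have "0 \<le> real i * h" using h by simp
      with that show ?thesis using range[of s] by auto
    qed
    have "(\<integral>\<^sup>+s. indicator {real i * h..(real i + 1) * h} s * ennreal (\<beta> s) \<partial>lborel)
      = (\<integral>\<^sup>+s. ennreal (indicator {real i * h..(real i + 1) * h} s * \<beta> s) \<partial>lborel)"
      by (intro nn_integral_cong) (auto split: split_indicator)
    also have "\<dots> = ennreal (integral {real i * h..(real i + 1) * h} \<beta>)"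
      using nn by (intro nn_integral_has_integral_lebesgue integrable_integral integrable_on_step)
    finally show ?thesis
      using h by (simp add: discount_weight_def)
  qed
  have "\<not> summable (discount_weight \<beta> h)"
  proof
    assume "summable (discount_weight \<beta> h)"
    then have "summable (\<lambda>i. h * discount_weight \<beta> h i)"
      by (rule summable_mult)
    then have fin: "(\<Sum>i. ennreal (h * discount_weight \<beta> h i)) < \<infinity>"
      using h discount_weight_pos
      by (subst suminf_ennreal2) (auto intro!: mult_nonneg_nonneg less_imp_le)
    have "(\<integral>\<^sup>+s\<in>{0..}. ennreal (\<beta> s) \<partial>lborel)
      \<le> (\<integral>\<^sup>+s. (\<Sum>i. indicator {real i * h..(real i + 1) * h} s * ennreal (\<beta> s)) \<partial>lborel)"
    proof (rule nn_integral_mono)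
      fix s :: real
      show "ennreal (\<beta> s) * indicator {0..} s
        \<le> (\<Sum>i. indicator {real i * h..(real i + 1) * h} s * ennreal (\<beta> s))"
      proof (cases "0 \<le> s")
        case True
        define i where "i = nat \<lfloor>s / h\<rfloor>"
        have "real i \<le> s / h" "s / h \<le> real i + 1"
          using True h by (auto simp: i_def)
        then have "s \<in> {real i * h..(real i + 1) * h}"
          using h by (auto simp: field_simps)
        then have "ennreal (\<beta> s) * indicator {0..} s =
            (\<Sum>j\<in>{i}. indicator {real j * h..(real j + 1) * h} s * ennreal (\<beta> s))"
          using True by simp
        also have "\<dots> \<le> (\<Sum>i. indicator {real i * h..(real i + 1) * h} s * ennreal (\<beta> s))"
          by (rule sum_le_suminf) auto
        finally show ?thesis .
      qed simp
    qed
    also have "\<dots> = (\<Sum>i. \<integral>\<^sup>+s. indicator {real i * h..(real i + 1) * h} s * ennreal (\<beta> s) \<partial>lborel)"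
    proof (rule nn_integral_suminf)
      fix i
      have sub: "{real i * h..(real i + 1) * h} \<subseteq> {0..}"
        using h by auto
      have "continuous_on {real i * h..(real i + 1) * h} \<beta>"
        by (rule continuous_on_subset[OF continuous sub])
      then have "(\<lambda>s. indicator {real i * h..(real i + 1) * h} s *\<^sub>R \<beta> s) \<in> borel_measurable borel"
        by (intro borel_measurable_continuous_on_indicator) auto
      then have "(\<lambda>s. ennreal (indicator {real i * h..(real i + 1) * h} s *\<^sub>R \<beta> s)) \<in> borel_measurable borel"
        by (rule measurable_compose[OF _ measurable_ennreal])
      moreover have "(\<lambda>s. ennreal (indicator {real i * h..(real i + 1) * h} s *\<^sub>R \<beta> s))
        = (\<lambda>s. indicator {real i * h..(real i + 1) * h} s * ennreal (\<beta> s))"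
        by (auto split: split_indicator)
      ultimately show "(\<lambda>s. indicator {real i * h..(real i + 1) * h} s * ennreal (\<beta> s)) \<in> borel_measurable lborel"
        by simp
    qed
    finally show False
      using fin assms by (simp add: step)
  qed
  then have unbounded: "\<exists>n. x < (\<Sum>i<n. discount_weight \<beta> h i)" for x
    using summableI_nonneg_bounded[of "discount_weight \<beta> h" x] discount_weight_pos
    by (meson less_imp_le not_le)
  have mono: "(\<Sum>i<m. discount_weight \<beta> h i) \<le> (\<Sum>i<n. discount_weight \<beta> h i)" if "m \<le> n" for m n
    using that discount_weight_pos by (intro sum_mono2) (auto intro: less_imp_le)
  show ?thesis
    unfolding filterlim_at_top eventually_sequentially
    by (meson unbounded mono less_imp_le order_trans)
qed

end

section \<open>Impulses on a grid\<close>

context standard_process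
begin

sublocale filtration "space (F \<infinity>)" F
  by (rule filtration_F)

lemma F_mono_measurable: "s \<le> t \<Longrightarrow> (\<lambda>\<omega>. \<omega>) \<in> F t \<rightarrow>\<^sub>M F s"
  using sets_F_mono[of s t] by (intro measurableI) (auto simp: space_F[of t] space_F[of s] dest: sets.sets_into_space)

lemma X_measurable: "0 \<le> s \<Longrightarrow> ennreal s \<le> t \<Longrightarrow> X s \<in> borel_measurable (F t)"
  using measurable_compose[OF F_mono_measurable adapted] .

lemma space_copies_filtration: "space (copies_filtration F i t) = space (copies F)"
  by (simp add: copies_filtration_def)

lemma copies_component: "1 \<le> j \<Longrightarrow> (\<lambda>\<omega>. \<omega> j) \<in> copies F \<rightarrow>\<^sub>M F \<infinity>"
  unfolding copies_def by (rule measurable_component_singleton) auto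

lemma copies_filtration_component:
  assumes "1 \<le> j" "j \<le> i" "s \<le> t"
  shows "(\<lambda>\<omega>. \<omega> j) \<in> copies_filtration F i t \<rightarrow>\<^sub>M F s"
proof -
  have "(\<lambda>\<omega>. restrict \<omega> {1..i}) \<in> copies_filtration F i t \<rightarrow>\<^sub>M (\<Pi>\<^sub>M j\<in>{1..i}. F t)"
    unfolding copies_filtration_def
    by (rule measurable_vimage_algebra1) (auto simp: copies_def space_PiM PiE_iff space_F[of t])
  from measurable_compose[OF this measurable_component_singleton[of j]]
  have "(\<lambda>\<omega>. \<omega> j) \<in> copies_filtration F i t \<rightarrow>\<^sub>M F t"
    using assms by simp
  from measurable_compose[OF this F_mono_measurable[OF assms(3)]] show ?thesis .
qed

text \<open>
  Measurability of the identity into a \<open>\<sigma>\<close>-field says that this \<open>\<sigma>\<close>-field is contained in the one of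
  \<open>N\<close>. In this form the inclusions between the histories of the first \<open>i\<close> copies compose with
  measurable functions.
\<close>

lemma measurable_into_copies_filtration:
  assumes "space N = space (copies F)" "\<And>j. 1 \<le> j \<Longrightarrow> j \<le> i \<Longrightarrow> (\<lambda>\<omega>. \<omega> j) \<in> N \<rightarrow>\<^sub>M F t"
  shows "(\<lambda>\<omega>. \<omega>) \<in> N \<rightarrow>\<^sub>M copies_filtration F i t"
  unfolding copies_filtration_def
  using assms by (intro measurable_vimage_algebra2 measurable_restrict) auto

lemma copies_filtration_mono:
  "i \<le> j \<Longrightarrow> s \<le> t \<Longrightarrow> (\<lambda>\<omega>. \<omega>) \<in> copies_filtration F j t \<rightarrow>\<^sub>M copies_filtration F i s"
  by (intro measurable_into_copies_filtration copies_filtration_component)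
    (auto simp: space_copies_filtration)

lemma copies_measurable_copies_filtration: "(\<lambda>\<omega>. \<omega>) \<in> copies F \<rightarrow>\<^sub>M copies_filtration F i t"
  by (intro measurable_into_copies_filtration measurable_compose[OF copies_component F_mono_measurable]) auto

lemma filtration_copies: "filtration (space (copies F)) (copies_filtration F i)"
proof
  fix s t :: ennreal assume "s \<le> t"
  show "sets (copies_filtration F i s) \<subseteq> sets (copies_filtration F i t)"
  proof
    fix A assume A: "A \<in> sets (copies_filtration F i s)"
    then have "A \<inter> space (copies_filtration F i t) = A"
      using sets.sets_into_space[OF A] by (simp add: space_copies_filtration Int_absorb2)
    with measurable_sets[OF copies_filtration_mono[OF order.refl \<open>s \<le> t\<close>, of i] A]
    show "A \<in> sets (copies_filtration F i t)"
      by simp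
  qed
qed (simp add: space_copies_filtration)

end

locale grid_impulses = standard_process F X P
  for F :: "ennreal \<Rightarrow> 'w measure"
    and X :: "real \<Rightarrow> 'w \<Rightarrow> 'e::{metric_space, second_countable_topology}"
    and P :: "'e \<Rightarrow> 'w measure" +
  fixes U :: "'e set" and h :: real and D :: "'e set" and \<psi> :: "'e \<Rightarrow> 'e" and \<xi>\<^sub>0 :: 'e
  assumes h: "0 < h"
    and D[measurable]: "D \<in> sets borel"
    and \<psi>_measurable: "\<psi> \<in> borel_measurable (restrict_space borel (- D))"
    and \<psi>_U: "\<psi> ` (- D) \<subseteq> U"
    and \<psi>_D: "\<psi> ` (- D) \<subseteq> D"
    and \<xi>\<^sub>0: "\<xi>\<^sub>0 \<in> U"
begin

abbreviation grid :: "nat \<Rightarrow> ennreal" where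
  "grid n \<equiv> ennreal (real n * h)"

abbreviation \<tau> :: "nat \<Rightarrow> (nat \<Rightarrow> 'w) \<Rightarrow> ennreal" where
  "\<tau> \<equiv> impulse_times X h D"

abbreviation \<xi> :: "nat \<Rightarrow> (nat \<Rightarrow> 'w) \<Rightarrow> 'e" where
  "\<xi> \<equiv> snd (induced_strategy X h D \<psi> \<xi>\<^sub>0)"

lemma grid_nonneg [simp]: "0 \<le> real n * h"
  using h by simp

lemma grid_real_le_iff [simp]: "real m * h \<le> real n * h \<longleftrightarrow> m \<le> n"
  using h by (simp add: mult_le_cancel_right)

lemma grid_real_eq_iff [simp]: "real m * h = real n * h \<longleftrightarrow> m = n"
  using h by auto

lemma grid_le_iff [simp]: "grid m \<le> grid n \<longleftrightarrow> m \<le> n"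
  by (simp add: ennreal_le_iff)

lemma grid_eq_iff [simp]: "grid m = grid n \<longleftrightarrow> m = n"
  by (metis grid_le_iff order_antisym order_refl)

lemma grid_less_iff [simp]: "grid m < grid n \<longleftrightarrow> m < n"
  by (metis grid_le_iff not_le)

lemma enn2real_grid [simp]: "enn2real (grid n) = real n * h"
  by (simp only: enn2real_ennreal grid_nonneg)

text \<open>
  As grid times have no finite accumulation point, the infimum in the definition is attained unless
  it is infinite; all later arguments use the exit time only through this alternative.
\<close>

lemma exit_time_from_cases:
  obtains (never) "exit_time_from X h D s \<omega> = \<infinity>" "\<And>m. s \<le> grid m \<Longrightarrow> X (real m * h) \<omega> \<in> D"
  | (at) n where "exit_time_from X h D s \<omega> = grid n" "s \<le> grid n" "X (real n * h) \<omega> \<notin> D"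
      "\<And>m. s \<le> grid m \<Longrightarrow> m < n \<Longrightarrow> X (real m * h) \<omega> \<in> D"
proof (cases "\<exists>n. s \<le> grid n \<and> X (real n * h) \<omega> \<notin> D")
  case False
  then have empty: "{n. s \<le> grid n \<and> X (real n * h) \<omega> \<notin> D} = {}" by blast
  have "exit_time_from X h D s \<omega> = \<infinity>"
    unfolding exit_time_from_def empty by simp
  then show ?thesis using never False by blast
next
  case True
  define n where "n = (LEAST n. s \<le> grid n \<and> X (real n * h) \<omega> \<notin> D)"
  have n: "s \<le> grid n \<and> X (real n * h) \<omega> \<notin> D"
    unfolding n_def using True by (rule LeastI_ex)
  have least: "n \<le> m" if "s \<le> grid m" "X (real m * h) \<omega> \<notin> D" for m
    unfolding n_def using that by (intro Least_le) auto
  have "exit_time_from X h D s \<omega> = grid n"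
    unfolding exit_time_from_def
    using n least by (intro antisym INF_lower INF_greatest) auto
  then show ?thesis using at n least by (metis not_le)
qed

lemma impulse_times_grid: "\<tau> i \<omega> = \<infinity> \<or> (\<exists>n. \<tau> i \<omega> = grid n)"
proof (cases i)
  case 0
  then show ?thesis by (auto intro: exI[of _ 0])
next
  case (Suc j)
  then show ?thesis
    by (cases rule: exit_time_from_cases[of "\<tau> j \<omega>" "\<omega> (Suc j)"]) auto
qed

lemma impulse_times_Suc_ge: "\<tau> i \<omega> \<le> \<tau> (Suc i) \<omega>"
  by (cases rule: exit_time_from_cases[of "\<tau> i \<omega>" "\<omega> (Suc i)"]) auto

lemma impulse_times_mono: "i \<le> j \<Longrightarrow> \<tau> i \<omega> \<le> \<tau> j \<omega>"
  using lift_Suc_mono_le[of "\<lambda>i. \<tau> i \<omega>", OF impulse_times_Suc_ge] .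

lemma impulse_time_outside: "\<tau> (Suc i) \<omega> = grid n \<Longrightarrow> X (real n * h) (\<omega> (Suc i)) \<notin> D"
  by (cases rule: exit_time_from_cases[of "\<tau> i \<omega>" "\<omega> (Suc i)"]) auto

text \<open>
  The recursion that gives measurability: an impulse has happened by time \<open>t\<close> iff at some grid time up
  to \<open>t\<close> its copy is already in use and outside \<open>D\<close>. Infinite \<open>t\<close> is excluded because the copy
  may never leave \<open>D\<close>.
\<close>

lemma impulse_time_le_iff:
  assumes "t \<noteq> \<infinity>"
  shows "\<tau> (Suc i) \<omega> \<le> t \<longleftrightarrow> (\<exists>n. grid n \<le> t \<and> \<tau> i \<omega> \<le> grid n \<and> X (real n * h) (\<omega> (Suc i)) \<notin> D)"
proof (cases rule: exit_time_from_cases[of "\<tau> i \<omega>" "\<omega> (Suc i)"])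
  case never
  then show ?thesis using assms by (auto simp: top_unique)
next
  case (at n)
  have "grid n \<le> t" if "grid m \<le> t" "\<tau> i \<omega> \<le> grid m" "X (real m * h) (\<omega> (Suc i)) \<notin> D" for m
  proof -
    have "n \<le> m" using at(4)[of m] that by (meson not_le)
    then show ?thesis using that(1) grid_le_iff order_trans by blast
  qed
  with at(1-3) show ?thesis
    by auto
qed

lemma grid_less_impulse_time_iff:
  "grid n < \<tau> (Suc i) \<omega> \<longleftrightarrow> (\<forall>m\<le>n. \<tau> i \<omega> \<le> grid m \<longrightarrow> X (real m * h) (\<omega> (Suc i)) \<in> D)"
  using impulse_time_le_iff[of "grid n" i \<omega>] by (auto simp: not_le[symmetric])

lemma stopping_time_impulse_times: "stopping_time (copies_filtration F i) (\<tau> i)"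
proof
  fix t show "Measurable.pred (copies_filtration F i t) (\<lambda>\<omega>. \<tau> i \<omega> \<le> t)"
  proof (induction i arbitrary: t)
    case (Suc i)
    have "Measurable.pred (copies_filtration F (Suc i) t)
       (\<lambda>\<omega>. grid n \<le> t \<and> \<tau> i \<omega> \<le> grid n \<and> X (real n * h) (\<omega> (Suc i)) \<notin> D)" for n
    proof (cases "grid n \<le> t")
      case True
      have [measurable]: "Measurable.pred (copies_filtration F (Suc i) t) (\<lambda>\<omega>. \<tau> i \<omega> \<le> grid n)"
        using measurable_compose[OF copies_filtration_mono Suc.IH] True by simp
      have [measurable]: "(\<lambda>\<omega>. X (real n * h) (\<omega> (Suc i))) \<in> borel_measurable (copies_filtration F (Suc i) t)"
        by (rule measurable_compose[OF copies_filtration_component[OF _ _ True] X_measurable]) auto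
      show ?thesis by measurable
    qed simp
    then have step: "Measurable.pred (copies_filtration F (Suc i) t)
       (\<lambda>\<omega>. \<exists>n. grid n \<le> t \<and> \<tau> i \<omega> \<le> grid n \<and> X (real n * h) (\<omega> (Suc i)) \<notin> D)"
      by (rule pred_intros_countable)
    then show ?case
    proof (cases "t = \<infinity>")
      case True
      then show ?thesis by (simp add: pred_def)
    next
      case False
      from step show ?thesis
        unfolding impulse_time_le_iff[OF False] .
    qed
  qed simp
qed

lemma pred_impulse_time_le:
  "grid n \<le> t \<Longrightarrow> Measurable.pred (copies_filtration F i t) (\<lambda>\<omega>. \<tau> i \<omega> \<le> grid n)"
  using filtration.stopping_time_le_const[OF filtration_copies stopping_time_impulse_times] .

lemma pred_impulse_time_eq:
  assumes "grid n \<le> t"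
  shows "Measurable.pred (copies_filtration F i t) (\<lambda>\<omega>. \<tau> i \<omega> = grid n)"
proof -
  have eq: "\<tau> i \<omega> = grid n \<longleftrightarrow> \<tau> i \<omega> \<le> grid n \<and> (\<forall>m\<in>{..<n}. \<not> \<tau> i \<omega> \<le> grid m)" for \<omega>
    using impulse_times_grid[of i \<omega>] by (auto simp: top_unique not_le)
  have le: "Measurable.pred (copies_filtration F i t) (\<lambda>\<omega>. \<tau> i \<omega> \<le> grid m)" if "m \<le> n" for m
    by (rule pred_impulse_time_le) (meson assms grid_le_iff order_trans that)
  show ?thesis
    unfolding eq by (intro pred_intros_logic(2,3) pred_intros_finite(3) le) auto
qed

text \<open>
  The impulse map is only measurable on the complement of \<open>D\<close>; it is extended to the whole space so
  that it can be composed with random states.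
\<close>

lemma \<psi>_extended_measurable: "(\<lambda>z. if z \<in> D then f z else \<psi> z) \<in> borel_measurable borel"
  if [measurable]: "f \<in> borel_measurable borel"
proof -
  have "{z \<in> space borel. z \<in> D} \<in> sets borel" by measurable
  moreover have "f \<in> borel_measurable (restrict_space borel {z. z \<in> D})"
    by (rule measurable_restrict_space1) fact
  moreover have "{z. z \<notin> D} = - D" by auto
  ultimately show ?thesis
    using \<psi>_measurable by (subst measurable_If_restrict_space_iff) auto
qed

lemma \<xi>_eq: "\<xi> i \<omega> = (if \<tau> i \<omega> < \<infinity> then \<psi> (X (enn2real (\<tau> i \<omega>)) (\<omega> i)) else \<xi>\<^sub>0)"
  by (simp add: induced_strategy_def)

lemma \<xi>_past_measurable:
  assumes "1 \<le> i"
  shows "\<xi> i \<in> borel_measurable (past_at F i (\<tau> i))"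
proof (rule measurableI)
  fix B :: "'e set" assume [measurable]: "B \<in> sets borel"
  note [measurable] = \<psi>_extended_measurable[of "\<lambda>_. \<xi>\<^sub>0", OF measurable_const]
  obtain j where j: "i = Suc j" using assms by (cases i) auto
  show "\<xi> i -` B \<inter> space (past_at F i (\<tau> i)) \<in> sets (past_at F i (\<tau> i))"
    unfolding past_at_def filtration.space_pre_sigma[OF filtration_copies]
  proof (rule filtration.sets_pre_sigmaI[OF filtration_copies stopping_time_impulse_times])
    fix t
    \<comment> \<open>Split by the value of the impulse time; an infinite one is seen only by the \<open>\<sigma>\<close>-field at \<open>t = \<infinity>\<close>.\<close>
    have eq: "{\<omega> \<in> \<xi> i -` B \<inter> space (copies F). \<tau> i \<omega> \<le> t} =
      {\<omega> \<in> space (copies_filtration F i t).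
        (\<exists>n. grid n \<le> t \<and> \<tau> i \<omega> = grid n \<and>
           (if X (real n * h) (\<omega> i) \<in> D then \<xi>\<^sub>0 else \<psi> (X (real n * h) (\<omega> i))) \<in> B)
        \<or> (t = \<infinity> \<and> (\<forall>n. \<tau> i \<omega> \<noteq> grid n) \<and> \<xi>\<^sub>0 \<in> B)}" (is "?L = ?R")
    proof (rule set_eqI)
      fix \<omega>
      consider "\<tau> i \<omega> = \<infinity>" | n where "\<tau> i \<omega> = grid n"
        using impulse_times_grid by blast
      then show "\<omega> \<in> ?L \<longleftrightarrow> \<omega> \<in> ?R"
      proof cases
        case 1
        then show ?thesis by (auto simp: \<xi>_eq space_copies_filtration top_unique)
      next
        case 2
        with impulse_time_outside[of j \<omega> n] have "X (real n * h) (\<omega> i) \<notin> D"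
          by (simp add: j)
        with 2 show ?thesis by (auto simp: \<xi>_eq space_copies_filtration ennreal_less_top)
      qed
    qed
    have at: "Measurable.pred (copies_filtration F i t) (\<lambda>\<omega>. grid n \<le> t \<and> \<tau> i \<omega> = grid n \<and>
           (if X (real n * h) (\<omega> i) \<in> D then \<xi>\<^sub>0 else \<psi> (X (real n * h) (\<omega> i))) \<in> B)" for n
    proof (cases "grid n \<le> t")
      case True
      note [measurable] = pred_impulse_time_eq[OF True]
      have [measurable]: "(\<lambda>\<omega>. X (real n * h) (\<omega> i)) \<in> borel_measurable (copies_filtration F i t)"
        using assms by (intro measurable_compose[OF copies_filtration_component[OF _ _ True] X_measurable]) auto
      show ?thesis by measurable
    qed simp
    have never: "Measurable.pred (copies_filtration F i t) (\<lambda>\<omega>. t = \<infinity> \<and> (\<forall>n. \<tau> i \<omega> \<noteq> grid n) \<and> \<xi>\<^sub>0 \<in> B)"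
    proof (cases "t = \<infinity>")
      case True
      have [measurable]: "Measurable.pred (copies_filtration F i t) (\<lambda>\<omega>. \<tau> i \<omega> = grid n)" for n
        by (rule pred_impulse_time_eq) (simp add: True)
      show ?thesis by measurable
    qed simp
    show "{\<omega> \<in> \<xi> i -` B \<inter> space (copies F). \<tau> i \<omega> \<le> t} \<in> sets (copies_filtration F i t)"
      unfolding eq
      by (rule predE, rule pred_intros_logic(5)[OF pred_intros_countable(2)[OF at] never])
  qed
qed simp

lemma \<xi>_mem_U:
  assumes "1 \<le> i"
  shows "\<xi> i \<omega> \<in> U"
proof -
  obtain j where j: "i = Suc j" using assms by (cases i) auto
  show ?thesis
    using impulse_times_grid[of i \<omega>] impulse_time_outside[of j \<omega>] \<psi>_U \<xi>\<^sub>0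
    by (auto simp: \<xi>_eq j simp del: impulse_times.simps)
qed

lemma induced_strategy_admissible: "induced_strategy X h D \<psi> \<xi>\<^sub>0 \<in> grid_strategies F U h"
proof -
  have "induced_strategy X h D \<psi> \<xi>\<^sub>0 = (\<tau>, \<xi>)"
    by (simp add: induced_strategy_def)
  then show ?thesis
    unfolding grid_strategies_def strategies_def
    using stopping_time_impulse_times \<xi>_past_measurable \<xi>_mem_U impulse_times_grid impulse_times_mono
    by (auto simp del: impulse_times.simps(2)) (metis infinity_ennreal_def)
qed

lemma impulse_at_past:
  "{\<omega> \<in> space (copies F). \<tau> i \<omega> = grid n} \<in> sets (past_at F i (\<tau> i))"
  unfolding past_at_def
proof (rule filtration.sets_pre_sigmaI[OF filtration_copies stopping_time_impulse_times])
  fix t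
  have "{\<omega> \<in> {\<omega> \<in> space (copies F). \<tau> i \<omega> = grid n}. \<tau> i \<omega> \<le> t} =
      {\<omega> \<in> space (copies_filtration F i t). grid n \<le> t \<and> \<tau> i \<omega> = grid n}"
    by (auto simp: space_copies_filtration)
  also have "\<dots> \<in> sets (copies_filtration F i t)"
    using pred_impulse_time_eq[of n t i] by (cases "grid n \<le> t") (auto simp: pred_def)
  finally show "{\<omega> \<in> {\<omega> \<in> space (copies F). \<tau> i \<omega> = grid n}. \<tau> i \<omega> \<le> t} \<in> sets (copies_filtration F i t)" .
qed

end

section \<open>One step of the uncontrolled process\<close>

text \<open>
  The Markov property and the law of the controlled system are given for events only. This lemma
  passes to nonnegative functions by the standard approximation, for which the conditional laws
  have to form a measurable kernel.
\<close>

lemma nn_integral_of_disintegration: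
  assumes Y: "Y \<in> M \<rightarrow>\<^sub>M N" and Z: "Z \<in> M \<rightarrow>\<^sub>M N'" and K: "K \<in> N' \<rightarrow>\<^sub>M subprob_algebra N"
    and A: "A \<in> sets M" and A': "A' \<in> sets M"
    and sets: "\<And>B. B \<in> sets N \<Longrightarrow>
      emeasure M {\<omega>\<in>A. Y \<omega> \<in> B} = (\<integral>\<^sup>+\<omega>. indicator A' \<omega> * emeasure (K (Z \<omega>)) B \<partial>M)"
    and f: "f \<in> borel_measurable N"
  shows "(\<integral>\<^sup>+\<omega>. indicator A \<omega> * f (Y \<omega>) \<partial>M) = (\<integral>\<^sup>+\<omega>. indicator A' \<omega> * (\<integral>\<^sup>+y. f y \<partial>K (Z \<omega>)) \<partial>M)"
  using f
proof induction
  note [measurable] = Y Z K A A'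
  have K_sets: "sets (K (Z \<omega>)) = sets N" if "\<omega> \<in> space M" for \<omega>
    using measurable_space[OF Z that] measurable_space[OF K] by (auto simp: space_subprob_algebra)
  have K_space: "space (K (Z \<omega>)) = space N" if "\<omega> \<in> space M" for \<omega>
    using K_sets[OF that] by (rule sets_eq_imp_space_eq)
  have K_meas: "g \<in> borel_measurable (K (Z \<omega>))" if "\<omega> \<in> space M" "g \<in> borel_measurable N"
    for \<omega> and g :: "_ \<Rightarrow> ennreal"
    using measurable_cong_sets[OF K_sets[OF that(1)] refl] that(2) by auto
  {
    case (cong f g)
    have "(\<integral>\<^sup>+\<omega>. indicator A \<omega> * f (Y \<omega>) \<partial>M) = (\<integral>\<^sup>+\<omega>. indicator A \<omega> * g (Y \<omega>) \<partial>M)"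
      using measurable_space[OF Y] cong(3) by (intro nn_integral_cong) simp
    moreover have "(\<integral>\<^sup>+\<omega>. indicator A' \<omega> * (\<integral>\<^sup>+y. f y \<partial>K (Z \<omega>)) \<partial>M)
        = (\<integral>\<^sup>+\<omega>. indicator A' \<omega> * (\<integral>\<^sup>+y. g y \<partial>K (Z \<omega>)) \<partial>M)"
      using cong(3) by (intro nn_integral_cong arg_cong2[where f="(*)"] refl) (simp add: K_space)
    ultimately show ?case using cong(4) by simp
  next
    case (set B)
    note [measurable] = set
    have "(\<integral>\<^sup>+\<omega>. indicator A \<omega> * indicator B (Y \<omega>) \<partial>M) = (\<integral>\<^sup>+\<omega>. indicator {\<omega>\<in>A. Y \<omega> \<in> B} \<omega> \<partial>M)"
      by (intro nn_integral_cong) (auto split: split_indicator)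
    also have "\<dots> = emeasure M {\<omega>\<in>A. Y \<omega> \<in> B}"
    proof (rule nn_integral_indicator)
      have "{\<omega>\<in>A. Y \<omega> \<in> B} = A \<inter> {\<omega>\<in>space M. Y \<omega> \<in> B}"
        using sets.sets_into_space[OF A] by auto
      then show "{\<omega>\<in>A. Y \<omega> \<in> B} \<in> sets M" by simp
    qed
    also have "\<dots> = (\<integral>\<^sup>+\<omega>. indicator A' \<omega> * (\<integral>\<^sup>+y. indicator B y \<partial>K (Z \<omega>)) \<partial>M)"
      unfolding sets[OF set] by (intro nn_integral_cong) (simp add: K_sets set)
    finally show ?case .
  next
    case (mult u r)
    note [measurable] = mult(2)
    have "(\<integral>\<^sup>+\<omega>. indicator A \<omega> * (r * u (Y \<omega>)) \<partial>M) = r * (\<integral>\<^sup>+\<omega>. indicator A \<omega> * u (Y \<omega>) \<partial>M)"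
      by (subst nn_integral_cmult[symmetric]) (auto intro!: nn_integral_cong simp: ac_simps)
    also have "\<dots> = (\<integral>\<^sup>+\<omega>. r * (indicator A' \<omega> * (\<integral>\<^sup>+y. u y \<partial>K (Z \<omega>))) \<partial>M)"
      unfolding mult(4) by (subst nn_integral_cmult) auto
    also have "\<dots> = (\<integral>\<^sup>+\<omega>. indicator A' \<omega> * (\<integral>\<^sup>+y. r * u y \<partial>K (Z \<omega>)) \<partial>M)"
      by (intro nn_integral_cong) (simp add: nn_integral_cmult K_meas mult(2) ac_simps)
    finally show ?case .
  next
    case (add u v)
    note [measurable] = add(1,3)
    have "(\<integral>\<^sup>+\<omega>. indicator A \<omega> * (v (Y \<omega>) + u (Y \<omega>)) \<partial>M) =
        (\<integral>\<^sup>+\<omega>. indicator A \<omega> * v (Y \<omega>) \<partial>M) + (\<integral>\<^sup>+\<omega>. indicator A \<omega> * u (Y \<omega>) \<partial>M)"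
      by (subst nn_integral_add[symmetric]) (auto simp: distrib_left)
    also have "\<dots> = (\<integral>\<^sup>+\<omega>. indicator A' \<omega> * (\<integral>\<^sup>+y. v y \<partial>K (Z \<omega>)) + indicator A' \<omega> * (\<integral>\<^sup>+y. u y \<partial>K (Z \<omega>)) \<partial>M)"
      unfolding add by (subst nn_integral_add) auto
    also have "\<dots> = (\<integral>\<^sup>+\<omega>. indicator A' \<omega> * (\<integral>\<^sup>+y. v y + u y \<partial>K (Z \<omega>)) \<partial>M)"
      by (intro nn_integral_cong) (simp add: nn_integral_add K_meas add(1,3) distrib_left)
    finally show ?case .
  next
    case (seq U)
    note [measurable] = seq(1)
    have mono: "U i y \<le> U (Suc i) y" for i y
      using \<open>incseq U\<close> by (auto simp: incseq_Suc_iff le_fun_def)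
    have "(\<integral>\<^sup>+\<omega>. indicator A \<omega> * (SUP i. U i) (Y \<omega>) \<partial>M) = (\<integral>\<^sup>+\<omega>. (SUP i. indicator A \<omega> * U i (Y \<omega>)) \<partial>M)"
      by (simp add: SUP_mult_left_ennreal image_comp)
    also have "\<dots> = (SUP i. \<integral>\<^sup>+\<omega>. indicator A \<omega> * U i (Y \<omega>) \<partial>M)"
      by (intro nn_integral_monotone_convergence_SUP)
        (auto simp: incseq_Suc_iff le_fun_def intro!: mult_left_mono mono)
    also have "\<dots> = (SUP i. \<integral>\<^sup>+\<omega>. indicator A' \<omega> * (\<integral>\<^sup>+y. U i y \<partial>K (Z \<omega>)) \<partial>M)"
      using seq.IH by simp
    also have "\<dots> = (\<integral>\<^sup>+\<omega>. (SUP i. indicator A' \<omega> * (\<integral>\<^sup>+y. U i y \<partial>K (Z \<omega>))) \<partial>M)"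
      by (intro nn_integral_monotone_convergence_SUP[symmetric])
        (auto simp: incseq_Suc_iff le_fun_def intro!: mult_left_mono nn_integral_mono mono)
    also have "\<dots> = (\<integral>\<^sup>+\<omega>. indicator A' \<omega> * (\<integral>\<^sup>+y. (SUP i. U i) y \<partial>K (Z \<omega>)) \<partial>M)"
    proof (intro nn_integral_cong)
      fix \<omega> assume "\<omega> \<in> space M"
      then have "(\<integral>\<^sup>+y. (SUP i. U i y) \<partial>K (Z \<omega>)) = (SUP i. \<integral>\<^sup>+y. U i y \<partial>K (Z \<omega>))"
        using \<open>incseq U\<close> seq(1) by (intro nn_integral_monotone_convergence_SUP K_meas) auto
      then show "(SUP i. indicator A' \<omega> * (\<integral>\<^sup>+y. U i y \<partial>K (Z \<omega>)))
          = indicator A' \<omega> * (\<integral>\<^sup>+y. (SUP i. U i) y \<partial>K (Z \<omega>))"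
        by (simp add: SUP_mult_left_ennreal image_comp)
    qed
    finally show ?case .
  }
qed

context grid_impulses
begin

lemma space_P: "space (P x) = space (F \<infinity>)"
  using sets_P by (rule sets_eq_imp_space_eq)

lemma X_measurable_P [measurable]: "0 \<le> t \<Longrightarrow> X t \<in> borel_measurable (P x)"
  using X_measurable[of t \<infinity>] measurable_cong_sets[OF sets_P refl] by auto

definition step :: "('e \<Rightarrow> ennreal) \<Rightarrow> 'e \<Rightarrow> ennreal" where
  "step f x = (\<integral>\<^sup>+\<omega>. f (X h \<omega>) \<partial>P x)"

text \<open>
  Transition operator of the grid chain killed as soon as it is found outside \<open>D\<close>: the state at which
  the step starts has to be in \<open>D\<close>, the one at which it ends need not be.
\<close>

definition killed_step :: "('e \<Rightarrow> ennreal) \<Rightarrow> 'e \<Rightarrow> ennreal" where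
  "killed_step f x = indicator D x * step f x"

lemma transition_kernel: "(\<lambda>x. distr (P x) borel (X h)) \<in> borel \<rightarrow>\<^sub>M subprob_algebra borel"
proof (rule measurable_subprob_algebra)
  show "subprob_space (distr (P x) borel (X h))" for x
    using h by (intro prob_space_imp_subprob_space prob_space.prob_space_distr prob_space_P) simp
  fix A :: "'e set" assume "A \<in> sets borel"
  moreover from this have "emeasure (distr (P x) borel (X h)) A = emeasure (P x) {\<omega>\<in>space (F \<infinity>). X h \<omega> \<in> A}" for x
    using h by (subst emeasure_distr) (auto simp: space_P intro!: arg_cong[where f="emeasure _"])
  ultimately show "(\<lambda>x. emeasure (distr (P x) borel (X h)) A) \<in> borel_measurable borel"
    using measurable_kernel[of h A] h by simp
qed simp

lemma step_eq_kernel: "f \<in> borel_measurable borel \<Longrightarrow> step f x = (\<integral>\<^sup>+y. f y \<partial>distr (P x) borel (X h))"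
  unfolding step_def using h by (subst nn_integral_distr) auto

lemma step_measurable [measurable]:
  assumes "f \<in> borel_measurable borel" shows "step f \<in> borel_measurable borel"
  unfolding step_eq_kernel[OF assms, abs_def]
  by (rule measurable_compose[OF transition_kernel nn_integral_measurable_subprob_algebra[OF assms]])

lemma killed_step_measurable [measurable]:
  "f \<in> borel_measurable borel \<Longrightarrow> killed_step f \<in> borel_measurable borel"
  unfolding killed_step_def[abs_def] by measurable

lemma killed_steps_measurable [measurable]:
  "f \<in> borel_measurable borel \<Longrightarrow> (killed_step ^^ m) f \<in> borel_measurable borel"
  by (induction m arbitrary: f) auto

text \<open>
  The strong Markov property at a constant time.
\<close>

lemma Markov_at_grid:
  assumes A: "A \<in> sets (F (grid n))" and f: "f \<in> borel_measurable borel"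
  shows "(\<integral>\<^sup>+\<omega>. indicator A \<omega> * f (X (real (Suc n) * h) \<omega>) \<partial>P x)
    = (\<integral>\<^sup>+\<omega>. indicator A \<omega> * step f (X (real n * h) \<omega>) \<partial>P x)"
  unfolding step_eq_kernel[OF f]
proof (rule nn_integral_of_disintegration[OF _ _ transition_kernel _ _ _ f])
  show "X (real (Suc n) * h) \<in> borel_measurable (P x)" "X (real n * h) \<in> borel_measurable (P x)"
    by (rule X_measurable_P grid_nonneg)+
  show A_P: "A \<in> sets (P x)" "A \<in> sets (P x)"
    using A sets_F_mono[of "grid n" \<infinity>] by (auto simp: sets_P)
  fix B :: "'e set" assume B: "B \<in> sets borel"
  have "A \<in> sets (pre_sigma (\<lambda>_. grid n))"
  proof (rule sets_pre_sigmaI[OF stopping_time_const])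
    show "{\<omega> \<in> A. grid n \<le> t} \<in> sets (F t)" for t
      using A sets_F_mono[of "grid n" t] by (cases "grid n \<le> t") auto
  qed
  from strong_Markov[OF stopping_time_const this, of h B x] B h
  have "emeasure (P x) {\<omega> \<in> A. X (real n * h + h) \<omega> \<in> B} =
    (\<integral>\<^sup>+\<omega>\<in>A. emeasure (P (X (real n * h) \<omega>)) {\<omega>' \<in> space (F \<infinity>). X h \<omega>' \<in> B} \<partial>P x)"
    by (simp add: ennreal_less_top)
  moreover have "emeasure (P y) {\<omega>' \<in> space (F \<infinity>). X h \<omega>' \<in> B} = emeasure (distr (P y) borel (X h)) B" for y
    using h B by (subst emeasure_distr) (auto simp: space_P intro!: arg_cong[where f="emeasure _"])
  moreover have "real (Suc n) * h = real n * h + h"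
    by (simp add: algebra_simps)
  ultimately show "emeasure (P x) {\<omega> \<in> A. X (real (Suc n) * h) \<omega> \<in> B} =
    (\<integral>\<^sup>+\<omega>. indicator A \<omega> * emeasure (distr (P (X (real n * h) \<omega>)) borel (X h)) B \<partial>P x)"
    by (simp add: mult.commute)
qed

text \<open>
  The event that the killed chain is alive after \<open>m\<close> steps.
\<close>

definition inside :: "nat \<Rightarrow> 'w set" where
  "inside m = {\<omega>\<in>space (F \<infinity>). \<forall>j<m. X (real j * h) \<omega> \<in> D}"

lemma inside_Suc: "\<omega> \<in> inside (Suc m) \<longleftrightarrow> \<omega> \<in> inside m \<and> X (real m * h) \<omega> \<in> D"
  by (auto simp: inside_def less_Suc_eq)

lemma inside_Suc_past: "inside (Suc m) \<in> sets (F (grid m))"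
proof -
  have [measurable]: "X (real j * h) \<in> borel_measurable (F (grid m))" if "j \<in> {..<Suc m}" for j
    using that by (intro X_measurable) auto
  have "{\<omega>\<in>space (F (grid m)). \<forall>j\<in>{..<Suc m}. X (real j * h) \<omega> \<in> D} \<in> sets (F (grid m))"
    by measurable
  also have "{\<omega>\<in>space (F (grid m)). \<forall>j\<in>{..<Suc m}. X (real j * h) \<omega> \<in> D} = inside (Suc m)"
    unfolding space_F[of "grid m"] inside_def by auto
  finally show ?thesis .
qed

lemma inside_measurable [measurable]: "inside m \<in> sets (P x)"
proof (cases m)
  case 0
  have "inside 0 = space (P x)" by (simp add: inside_def space_P)
  then show ?thesis using 0 by simp
next
  case (Suc n)
  then show ?thesis
    using inside_Suc_past[of n] sets_F_mono[of "grid n" \<infinity>] by (auto simp: sets_P)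
qed

text \<open>
  By induction on \<open>m\<close>, peeling off the last step: conditioning on the past at time \<open>m * h\<close> replaces
  \<open>f\<close> by its image under one step, and the requirement to be in \<open>D\<close> at that time is absorbed by
  the killed step.
\<close>

lemma killed_path_expectation:
  assumes "f \<in> borel_measurable borel"
  shows "(\<integral>\<^sup>+\<omega>. indicator (inside m) \<omega> * f (X (real m * h) \<omega>) \<partial>P x) = (killed_step ^^ m) f x"
  using assms
proof (induction m arbitrary: f)
  case 0
  have "(\<integral>\<^sup>+\<omega>. indicator (inside 0) \<omega> * f (X (real 0 * h) \<omega>) \<partial>P x) = (\<integral>\<^sup>+\<omega>. f x \<partial>P x)"
    using start[of x] AE_space[of "P x"] by (intro nn_integral_cong_AE) (auto simp: space_P inside_def)
  then show ?case
    using prob_space.emeasure_space_1[OF prob_space_P] by simp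
next
  case (Suc m)
  have "(\<integral>\<^sup>+\<omega>. indicator (inside (Suc m)) \<omega> * f (X (real (Suc m) * h) \<omega>) \<partial>P x)
    = (\<integral>\<^sup>+\<omega>. indicator (inside (Suc m)) \<omega> * step f (X (real m * h) \<omega>) \<partial>P x)"
    by (rule Markov_at_grid[OF inside_Suc_past Suc.prems])
  also have "\<dots> = (\<integral>\<^sup>+\<omega>. indicator (inside m) \<omega> * killed_step f (X (real m * h) \<omega>) \<partial>P x)"
    by (intro nn_integral_cong) (auto simp: killed_step_def inside_Suc split: split_indicator)
  also have "\<dots> = (killed_step ^^ m) (killed_step f) x"
    by (rule Suc.IH) (rule killed_step_measurable[OF Suc.prems])
  finally show ?case
    by (simp add: funpow_swap1)
qed

text \<open>
  The operator \<open>killed_step ^^ m\<close> as a kernel of measures.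
\<close>

definition killed_kernel :: "nat \<Rightarrow> 'e \<Rightarrow> 'e measure" where
  "killed_kernel m x = distr (density (P x) (indicator (inside m))) borel (X (real m * h))"

lemma nn_integral_killed_kernel:
  assumes f: "f \<in> borel_measurable borel"
  shows "(\<integral>\<^sup>+y. f y \<partial>killed_kernel m x) = (killed_step ^^ m) f x"
proof -
  have X: "X (real m * h) \<in> borel_measurable (P x)"
    by (rule X_measurable_P grid_nonneg)+
  have "(\<integral>\<^sup>+y. f y \<partial>killed_kernel m x) = (\<integral>\<^sup>+\<omega>. f (X (real m * h) \<omega>) \<partial>density (P x) (indicator (inside m)))"
    unfolding killed_kernel_def using X f by (intro nn_integral_distr) auto
  also have "\<dots> = (\<integral>\<^sup>+\<omega>. indicator (inside m) \<omega> * f (X (real m * h) \<omega>) \<partial>P x)"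
    using measurable_compose[OF X f]
    by (intro nn_integral_density borel_measurable_indicator inside_measurable)
  finally show ?thesis
    by (simp add: killed_path_expectation f)
qed

lemma emeasure_killed_kernel:
  assumes [measurable]: "B \<in> sets borel"
  shows "emeasure (killed_kernel m x) B = (killed_step ^^ m) (indicator B) x"
proof -
  have "emeasure (killed_kernel m x) B = (\<integral>\<^sup>+y. indicator B y \<partial>killed_kernel m x)"
    using assms by (subst nn_integral_indicator) (auto simp: killed_kernel_def)
  then show ?thesis by (simp add: nn_integral_killed_kernel)
qed

lemma killed_kernel_measurable: "killed_kernel m \<in> borel \<rightarrow>\<^sub>M subprob_algebra borel"
proof (rule measurable_subprob_algebra)
  fix x
  have [measurable]: "X (real m * h) \<in> borel_measurable (P x)"
    by (rule X_measurable_P grid_nonneg)+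
  interpret prob_space "P x" by (rule prob_space_P)
  have "space (killed_kernel m x) = UNIV"
    by (simp add: killed_kernel_def)
  then have "emeasure (killed_kernel m x) (space (killed_kernel m x)) = (\<integral>\<^sup>+\<omega>. indicator (inside m) \<omega> * 1 \<partial>P x)"
    using emeasure_killed_kernel[where B=UNIV and m=m and x=x] killed_path_expectation[where f="\<lambda>_. 1" and m=m and x=x]
    by (simp add: indicator_def)
  also have "\<dots> = emeasure (P x) (inside m)"
    by simp
  also have "\<dots> \<le> 1" by (rule emeasure_le_1)
  finally show "subprob_space (killed_kernel m x)"
    by (intro subprob_spaceI) (auto simp: killed_kernel_def)
  show "sets (killed_kernel m x) = sets borel"
    by (simp add: killed_kernel_def)
next
  fix B :: "'e set" assume [measurable]: "B \<in> sets borel"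
  show "(\<lambda>x. emeasure (killed_kernel m x) B) \<in> borel_measurable borel"
    by (simp add: emeasure_killed_kernel)
qed

text \<open>
  A path that starts in \<open>D\<close> does not exit before time \<open>h\<close>, so that the sum has the single term at
  time \<open>0\<close> and the stopped state is the one at time \<open>h\<close>.
\<close>

lemma one_step_Poisson:
  fixes w g :: "'e \<Rightarrow> real"
  assumes [measurable]: "w \<in> borel_measurable borel" "g \<in> borel_measurable borel"
    and w_bounded: "bounded (range w)"
    and Poisson: "w x =
      (\<integral>\<omega>. (\<Sum>i\<in>{i. i < 1 \<and> ennreal (real i * h) < exit_time X h D \<omega>}. (g (X (real i * h) \<omega>) - lam))
            + w (X (enn2real (min (ennreal (real (1::nat) * h)) (exit_time X h D \<omega>))) \<omega>) \<partial>P x)"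
    and x: "x \<in> D"
  shows "(\<integral>\<omega>. w (X h \<omega>) \<partial>P x) = w x - g x + lam"
proof -
  interpret prob_space "P x" by (rule prob_space_P)
  have [measurable]: "X h \<in> borel_measurable (P x)" "X 0 \<in> borel_measurable (P x)"
    using h by (auto intro: X_measurable_P)
  \<comment> \<open>The integrand in terms of the states at times \<open>0\<close> and \<open>h\<close> only, which shows its measurability.\<close>
  define G where "G \<omega> = (if X 0 \<omega> \<in> D then g (X 0 \<omega>) - lam + w (X h \<omega>) else w (X 0 \<omega>))" for \<omega>
  have eq: "(\<Sum>i\<in>{i. i < 1 \<and> ennreal (real i * h) < exit_time X h D \<omega>}. (g (X (real i * h) \<omega>) - lam))
            + w (X (enn2real (min (ennreal (real (1::nat) * h)) (exit_time X h D \<omega>))) \<omega>) = G \<omega>" for \<omega>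
  proof (cases "X 0 \<omega> \<in> D")
    case True
    have "grid 1 \<le> exit_time X h D \<omega>"
      unfolding exit_time_def
    proof (cases rule: exit_time_from_cases[of 0 \<omega>])
      case (at n)
      then have "n \<noteq> 0" using True by (intro notI) simp
      then show "grid 1 \<le> exit_time_from X h D 0 \<omega>"
        unfolding at(1) grid_le_iff by simp
    qed simp
    moreover from this have "0 < exit_time X h D \<omega>"
      using h by (metis grid_less_iff ennreal_0 mult_zero_left of_nat_0 less_le_trans zero_less_one)
    moreover from this have "{i. i < 1 \<and> ennreal (real i * h) < exit_time X h D \<omega>} = {0}"
      by auto
    ultimately show ?thesis
      using True h by (simp add: G_def min_absorb1)
  next
    case False
    have zero: "exit_time X h D \<omega> = 0"
      unfolding exit_time_def
    proof (cases rule: exit_time_from_cases[of 0 \<omega>])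
      case never
      from never(2)[of 0] False show "exit_time_from X h D 0 \<omega> = 0" by simp
    next
      case (at n)
      from at(4)[of 0] False have "n = 0" by auto
      then show "exit_time_from X h D 0 \<omega> = 0" using at(1) by simp
    qed
    then show ?thesis using False by (simp add: G_def)
  qed
  obtain K where K: "\<bar>w y\<bar> \<le> K" for y
    using w_bounded by (auto simp: bounded_iff)
  have int: "integrable (P x) (\<lambda>\<omega>. w (X h \<omega>))"
    using K by (intro integrable_const_bound[where B=K]) auto
  have "w x = (\<integral>\<omega>. G \<omega> \<partial>P x)"
    using Poisson unfolding eq .
  also have "\<dots> = (\<integral>\<omega>. (g x - lam) + w (X h \<omega>) \<partial>P x)"
    using start[of x] x by (intro integral_cong_AE) (auto simp: G_def[abs_def])
  also have "\<dots> = (g x - lam) + (\<integral>\<omega>. w (X h \<omega>) \<partial>P x)"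
    using int by (simp add: prob_space)
  finally show ?thesis by simp
qed

end

section \<open>The controlled process on the grid\<close>

locale controlled_grid = grid_impulses F X P U h D \<psi> \<xi>\<^sub>0
  for F :: "ennreal \<Rightarrow> 'w measure"
    and X :: "real \<Rightarrow> 'w \<Rightarrow> 'e::{metric_space, second_countable_topology}"
    and P U h D \<psi> \<xi>\<^sub>0 +
  fixes x :: 'e and M :: "(nat \<Rightarrow> 'w) measure"
  assumes law: "controlled_law F X P x (induced_strategy X h D \<psi> \<xi>\<^sub>0) M"
begin

sublocale prob_space M
  using law by (simp add: controlled_law_def split: prod.splits)

lemma sets_M: "sets M = sets (copies F)"
  using law by (simp add: controlled_law_def split: prod.splits)

lemma space_M: "space M = space (copies F)"
  using sets_M by (rule sets_eq_imp_space_eq)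

lemma first_copy_law:
  "C \<in> sets (\<Pi>\<^sub>M t\<in>{0..}. borel) \<Longrightarrow>
   emeasure M {\<omega>\<in>space M. path_from X 0 (\<omega> 1) \<in> C} =
   emeasure (P x) {\<omega>\<in>space (F \<infinity>). path_from X 0 \<omega> \<in> C}"
  using law by (auto simp: controlled_law_def space_M split: prod.splits)

lemma law_after_impulse:
  assumes "1 \<le> i"
  shows "AE \<omega> in M. \<tau> i \<omega> < \<infinity> \<longrightarrow> X (enn2real (\<tau> i \<omega>)) (\<omega> (i + 1)) = \<xi> i \<omega>"
    and "A \<in> sets (past_at F i (\<tau> i)) \<Longrightarrow> C \<in> sets (\<Pi>\<^sub>M t\<in>{0..}. borel) \<Longrightarrow>
      emeasure M {\<omega>\<in>A. \<tau> i \<omega> < \<infinity> \<and> path_from X (enn2real (\<tau> i \<omega>)) (\<omega> (i + 1)) \<in> C} =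
      (\<integral>\<^sup>+\<omega>\<in>{\<omega>\<in>A. \<tau> i \<omega> < \<infinity>}.
         emeasure (P (\<xi> i \<omega>)) {\<omega>'\<in>space (F \<infinity>). path_from X 0 \<omega>' \<in> C} \<partial>M)"
proof -
  have "induced_strategy X h D \<psi> \<xi>\<^sub>0 = (\<tau>, \<xi>)"
    by (simp add: induced_strategy_def)
  with law have "controlled_law F X P x (\<tau>, \<xi>) M"
    by simp
  then have *: "(AE \<omega> in M. \<tau> i \<omega> < \<infinity> \<longrightarrow> X (enn2real (\<tau> i \<omega>)) (\<omega> (i + 1)) = \<xi> i \<omega>) \<and>
        (\<forall>A\<in>sets (past_at F i (\<tau> i)). \<forall>C\<in>sets (\<Pi>\<^sub>M t\<in>{0..}. borel).
           emeasure M {\<omega>\<in>A. \<tau> i \<omega> < \<infinity> \<and> path_from X (enn2real (\<tau> i \<omega>)) (\<omega> (i + 1)) \<in> C} =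
           (\<integral>\<^sup>+\<omega>\<in>{\<omega>\<in>A. \<tau> i \<omega> < \<infinity>}.
              emeasure (P (\<xi> i \<omega>)) {\<omega>'\<in>space (F \<infinity>). path_from X 0 \<omega>' \<in> C} \<partial>M))"
    unfolding controlled_law_def prod.case using assms by blast
  show "AE \<omega> in M. \<tau> i \<omega> < \<infinity> \<longrightarrow> X (enn2real (\<tau> i \<omega>)) (\<omega> (i + 1)) = \<xi> i \<omega>"
    by (rule conjunct1[OF *])
  show "emeasure M {\<omega>\<in>A. \<tau> i \<omega> < \<infinity> \<and> path_from X (enn2real (\<tau> i \<omega>)) (\<omega> (i + 1)) \<in> C} =
      (\<integral>\<^sup>+\<omega>\<in>{\<omega>\<in>A. \<tau> i \<omega> < \<infinity>}.
         emeasure (P (\<xi> i \<omega>)) {\<omega>'\<in>space (F \<infinity>). path_from X 0 \<omega>' \<in> C} \<partial>M)"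
    if "A \<in> sets (past_at F i (\<tau> i))" "C \<in> sets (\<Pi>\<^sub>M t\<in>{0..}. borel)"
    using bspec[OF bspec[OF conjunct2[OF *] that(1)] that(2)] .
qed

lemma copies_filtration_measurable_M:
  "f \<in> copies_filtration F i t \<rightarrow>\<^sub>M N \<Longrightarrow> f \<in> M \<rightarrow>\<^sub>M N"
  unfolding measurable_cong_sets[OF sets_M refl]
  by (rule measurable_compose[OF copies_measurable_copies_filtration])

lemma copy_measurable [measurable]: "(\<lambda>\<omega>. X (real n * h) (\<omega> (Suc i))) \<in> borel_measurable M"
  using measurable_compose[OF copies_component X_measurable[of "real n * h" \<infinity>], of "Suc i"]
    measurable_cong_sets[OF sets_M refl]
  by auto

lemma impulse_at_measurable [measurable]: "Measurable.pred M (\<lambda>\<omega>. \<tau> i \<omega> = grid n)"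
  by (rule copies_filtration_measurable_M[OF pred_impulse_time_eq[where t=\<infinity>]]) simp

lemma impulse_le_measurable [measurable]: "Measurable.pred M (\<lambda>\<omega>. \<tau> i \<omega> \<le> grid n)"
  by (rule copies_filtration_measurable_M[OF pred_impulse_time_le[where t=\<infinity>]]) simp

definition start_state :: "nat \<Rightarrow> (nat \<Rightarrow> 'w) \<Rightarrow> 'e" where
  "start_state i \<omega> = (if i = 0 then x else \<xi> i \<omega>)"

lemma start_state_measurable: "start_state i \<in> borel_measurable M"
proof (cases "i = 0")
  case False
  have sub: "A \<in> sets M" if "A \<in> sets (past_at F i (\<tau> i))" for A
  proof -
    have "{\<omega>\<in>A. \<tau> i \<omega> \<le> \<infinity>} \<in> sets (copies_filtration F i \<infinity>)"
      using filtration.sets_pre_sigmaD[OF filtration_copies stopping_time_impulse_times] that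
      unfolding past_at_def by blast
    then have A: "A \<in> sets (copies_filtration F i \<infinity>)"
      by simp
    have "A \<inter> space (copies F) = A"
      using sets.sets_into_space[OF A] by (auto simp: space_copies_filtration)
    with measurable_sets[OF copies_measurable_copies_filtration A] show ?thesis
      by (simp add: sets_M)
  qed
  have sp: "space (past_at F i (\<tau> i)) = space M"
    unfolding past_at_def filtration.space_pre_sigma[OF filtration_copies] space_M ..
  have "\<xi> i \<in> borel_measurable M"
  proof (rule measurableI)
    fix B :: "'e set" assume "B \<in> sets borel"
    from measurable_sets[OF \<xi>_past_measurable this, of i] False
    show "\<xi> i -` B \<inter> space M \<in> sets M"
      unfolding sp using sub by simp
  qed simp
  then show ?thesis
    using False by (simp add: start_state_def[abs_def])
qed (simp add: start_state_def[abs_def])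

text \<open>
  The event that the killed chain carried by copy \<open>Suc i\<close>, when started by the previous impulse at
  time \<open>k * h\<close>, is alive after \<open>m\<close> steps.
\<close>

definition on_copy :: "nat \<Rightarrow> nat \<Rightarrow> nat \<Rightarrow> (nat \<Rightarrow> 'w) set" where
  "on_copy i k m = {\<omega>\<in>space M. \<tau> i \<omega> = grid k \<and> (\<forall>j<m. X (real (k + j) * h) (\<omega> (Suc i)) \<in> D)}"

lemma on_copy_measurable [measurable]: "on_copy i k m \<in> sets M"
proof -
  have "{\<omega>\<in>space M. \<tau> i \<omega> = grid k \<and> (\<forall>j\<in>{..<m}. X (real (k + j) * h) (\<omega> (Suc i)) \<in> D)} \<in> sets M"
    by measurable
  also have "{\<omega>\<in>space M. \<tau> i \<omega> = grid k \<and> (\<forall>j\<in>{..<m}. X (real (k + j) * h) (\<omega> (Suc i)) \<in> D)} = on_copy i k m"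
    by (auto simp: on_copy_def)
  finally show ?thesis .
qed

lemma on_copy_Suc:
  "\<omega> \<in> on_copy i k (Suc m) \<longleftrightarrow> \<omega> \<in> on_copy i k m \<and> X (real (k + m) * h) (\<omega> (Suc i)) \<in> D"
  by (auto simp: on_copy_def less_Suc_eq)

text \<open>
  From the impulse on, the new copy follows the uncontrolled dynamics from the state after the
  impulse, conditionally on the past. The set \<open>C\<close> of paths that are in \<open>D\<close> at the grid times before
  the \<open>m\<close>-th and in \<open>B\<close> at the \<open>m\<close>-th translates this into the killed kernel.
\<close>

lemma copy_law:
  assumes B: "B \<in> sets borel"
  shows "emeasure M {\<omega>\<in>on_copy i k m. X (real (k + m) * h) (\<omega> (Suc i)) \<in> B} =
    (\<integral>\<^sup>+\<omega>. indicator (on_copy i k 0) \<omega> * emeasure (killed_kernel m (start_state i \<omega>)) B \<partial>M)"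
proof -
  define C where "C = {p\<in>space (\<Pi>\<^sub>M t\<in>{0::real..}. (borel :: 'e measure)).
    (\<forall>j\<in>{..<m}. p (real j * h) \<in> D) \<and> p (real m * h) \<in> B}"
  have [measurable]: "(\<lambda>p. p (real j * h)) \<in> (\<Pi>\<^sub>M t\<in>{0::real..}. (borel :: 'e measure)) \<rightarrow>\<^sub>M borel" for j
    by (rule measurable_component_singleton) simp
  have C: "C \<in> sets (\<Pi>\<^sub>M t\<in>{0..}. borel)"
    using B unfolding C_def by measurable
  have path: "path_from X s \<omega> \<in> C \<longleftrightarrow>
      (\<forall>j<m. X (s + real j * h) \<omega> \<in> D) \<and> X (s + real m * h) \<omega> \<in> B" for s \<omega>
    by (auto simp: C_def path_from_def space_PiM)
  have kernel: "emeasure (P y) {\<omega>\<in>space (F \<infinity>). path_from X 0 \<omega> \<in> C} = emeasure (killed_kernel m y) B" for y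
  proof -
    have X: "X (real m * h) \<in> borel_measurable (P y)"
      by (rule X_measurable_P grid_nonneg)+
    have "{\<omega>\<in>space (F \<infinity>). path_from X 0 \<omega> \<in> C} = inside m \<inter> (X (real m * h) -` B \<inter> space (P y))"
      unfolding path by (auto simp: inside_def space_P)
    then have "emeasure (P y) {\<omega>\<in>space (F \<infinity>). path_from X 0 \<omega> \<in> C}
      = (\<integral>\<^sup>+\<omega>. indicator (inside m \<inter> (X (real m * h) -` B \<inter> space (P y))) \<omega> \<partial>P y)"
      using inside_measurable[of m y] measurable_sets[OF X B] by (simp add: sets.Int)
    also have "\<dots> = (\<integral>\<^sup>+\<omega>. indicator (inside m) \<omega> * indicator B (X (real m * h) \<omega>) \<partial>P y)"
      by (intro nn_integral_cong) (auto split: split_indicator)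
    finally show ?thesis
      unfolding emeasure_killed_kernel[OF B] using B by (simp add: killed_path_expectation)
  qed
  have shift: "real k * h + real j * h = real (k + j) * h" for j
    by (simp add: algebra_simps)
  show ?thesis
  proof (cases "i = 0")
    case False
    have "{\<omega>\<in>on_copy i k m. X (real (k + m) * h) (\<omega> (Suc i)) \<in> B} =
      {\<omega> \<in> {\<omega> \<in> space (copies F). \<tau> i \<omega> = grid k}.
         \<tau> i \<omega> < \<infinity> \<and> path_from X (enn2real (\<tau> i \<omega>)) (\<omega> (i + 1)) \<in> C}"
      unfolding path by (auto simp: on_copy_def space_M shift ennreal_less_top)
    moreover have "{\<omega> \<in> {\<omega> \<in> space (copies F). \<tau> i \<omega> = grid k}. \<tau> i \<omega> < \<infinity>} = on_copy i k 0"
      by (auto simp: on_copy_def space_M ennreal_less_top)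
    ultimately show ?thesis
      using law_after_impulse(2)[OF _ impulse_at_past C, of i k, unfolded kernel] False
      by (simp add: start_state_def mult.commute)
  next
    case True
    have zero: "grid k = 0 \<longleftrightarrow> k = 0"
      using grid_eq_iff[of k 0] by simp
    show ?thesis
    proof (cases "k = 0")
      case True
      have "{\<omega>\<in>on_copy i k m. X (real (k + m) * h) (\<omega> (Suc i)) \<in> B} = {\<omega>\<in>space M. path_from X 0 (\<omega> 1) \<in> C}"
        unfolding path using True \<open>i = 0\<close> by (auto simp: on_copy_def)
      moreover have "on_copy i k 0 = space M"
        using True \<open>i = 0\<close> by (auto simp: on_copy_def)
      ultimately show ?thesis
        using first_copy_law[OF C, unfolded kernel] \<open>i = 0\<close>
          nn_integral_cmult_indicator[OF sets.top, of M "emeasure (killed_kernel m x) B"]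
        by (simp add: start_state_def emeasure_space_1 mult.commute)
    next
      case False
      then have "on_copy i k n = {}" for n
        using zero \<open>i = 0\<close> by (auto simp: on_copy_def)
      then show ?thesis by simp
    qed
  qed
qed

lemma copy_expectation:
  assumes "f \<in> borel_measurable borel"
  shows "(\<integral>\<^sup>+\<omega>. indicator (on_copy i k m) \<omega> * f (X (real (k + m) * h) (\<omega> (Suc i))) \<partial>M) =
    (\<integral>\<^sup>+\<omega>. indicator (on_copy i k 0) \<omega> * (killed_step ^^ m) f (start_state i \<omega>) \<partial>M)"
  unfolding nn_integral_killed_kernel[OF assms, symmetric]
  by (rule nn_integral_of_disintegration[OF copy_measurable start_state_measurable
        killed_kernel_measurable on_copy_measurable on_copy_measurable copy_law assms])

text \<open>
  Both sides are expectations of the killed chain started at \<open>start_state i\<close>: after \<open>Suc m\<close> steps with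
  \<open>f\<close> on the left, after \<open>m\<close> steps with \<open>killed_step f\<close> on the right.
\<close>

lemma copy_Markov:
  assumes f: "f \<in> borel_measurable borel"
  shows "(\<integral>\<^sup>+\<omega>. indicator (on_copy i k (Suc m)) \<omega> * f (X (real (k + Suc m) * h) (\<omega> (Suc i))) \<partial>M) =
    (\<integral>\<^sup>+\<omega>. indicator (on_copy i k (Suc m)) \<omega> * step f (X (real (k + m) * h) (\<omega> (Suc i))) \<partial>M)"
proof -
  have "(\<integral>\<^sup>+\<omega>. indicator (on_copy i k (Suc m)) \<omega> * f (X (real (k + Suc m) * h) (\<omega> (Suc i))) \<partial>M)
    = (\<integral>\<^sup>+\<omega>. indicator (on_copy i k 0) \<omega> * (killed_step ^^ m) (killed_step f) (start_state i \<omega>) \<partial>M)"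
    unfolding copy_expectation[OF f] by (simp add: funpow_swap1)
  also have "\<dots> = (\<integral>\<^sup>+\<omega>. indicator (on_copy i k m) \<omega> * killed_step f (X (real (k + m) * h) (\<omega> (Suc i))) \<partial>M)"
    by (rule copy_expectation[OF killed_step_measurable[OF f], symmetric])
  also have "\<dots> = (\<integral>\<^sup>+\<omega>. indicator (on_copy i k (Suc m)) \<omega> * step f (X (real (k + m) * h) (\<omega> (Suc i))) \<partial>M)"
    by (intro nn_integral_cong) (auto simp: on_copy_Suc killed_step_def split: split_indicator)
  finally show ?thesis .
qed

subsection \<open>The copy in use\<close>

text \<open>
  The number of impulses strictly before a grid time, computed along the path of the copy in use
  rather than from the impulse times. This makes it plainly measurable, and it never counts two
  impulses at the same time, even on the null set where impulse times coincide.
\<close>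

primrec impulses_before :: "nat \<Rightarrow> (nat \<Rightarrow> 'w) \<Rightarrow> nat" where
  "impulses_before 0 \<omega> = 0"
| "impulses_before (Suc n) \<omega> =
    (if X (real n * h) (\<omega> (Suc (impulses_before n \<omega>))) \<in> D then impulses_before n \<omega>
     else Suc (impulses_before n \<omega>))"

definition state_before :: "nat \<Rightarrow> (nat \<Rightarrow> 'w) \<Rightarrow> 'e" where
  "state_before n \<omega> = X (real n * h) (\<omega> (Suc (impulses_before n \<omega>)))"

definition state_after :: "nat \<Rightarrow> (nat \<Rightarrow> 'w) \<Rightarrow> 'e" where
  "state_after n \<omega> = X (real n * h) (\<omega> (Suc (impulses_before (Suc n) \<omega>)))"

text \<open>
  The outcomes at which each new copy is where the impulse puts it. As the impulse map takes values
  in \<open>D\<close>, two impulses at the same time are then impossible.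
\<close>

definition regular :: "(nat \<Rightarrow> 'w) \<Rightarrow> bool" where
  "regular \<omega> \<longleftrightarrow> (\<forall>i n. \<tau> (Suc i) \<omega> = grid n \<longrightarrow>
     X (real n * h) (\<omega> (Suc (Suc i))) = \<psi> (X (real n * h) (\<omega> (Suc i))))"

lemma AE_regular: "AE \<omega> in M. regular \<omega>"
proof -
  have "AE \<omega> in M. \<forall>i. \<tau> (Suc i) \<omega> < \<infinity> \<longrightarrow>
      X (enn2real (\<tau> (Suc i) \<omega>)) (\<omega> (Suc i + 1)) = \<xi> (Suc i) \<omega>"
    unfolding AE_all_countable by (intro allI law_after_impulse(1)) simp
  then show ?thesis
  proof eventually_elim
    case (elim \<omega>)
    show ?case
      unfolding regular_def
    proof (intro allI impI)
      fix i n assume "\<tau> (Suc i) \<omega> = grid n"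
      with elim[rule_format, of i] show "X (real n * h) (\<omega> (Suc (Suc i))) = \<psi> (X (real n * h) (\<omega> (Suc i)))"
        by (simp add: \<xi>_eq ennreal_less_top del: impulse_times.simps)
    qed
  qed
qed

lemma impulses_before_measurable [measurable]: "impulses_before n \<in> M \<rightarrow>\<^sub>M count_space UNIV"
proof (induction n)
  case (Suc n)
  note [measurable] = Suc
  have [measurable]: "(\<lambda>\<omega>. X (real n * h) (\<omega> (Suc (impulses_before n \<omega>)))) \<in> borel_measurable M"
    by (rule measurable_compose_countable[OF copy_measurable Suc])
  show ?case
    by (simp add: impulses_before.simps[abs_def])
qed (simp add: impulses_before.simps[abs_def])

lemma state_before_measurable [measurable]: "state_before n \<in> borel_measurable M"
  unfolding state_before_def[abs_def]
  by (rule measurable_compose_countable[OF copy_measurable impulses_before_measurable])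

lemma state_after_measurable [measurable]: "state_after n \<in> borel_measurable M"
  unfolding state_after_def[abs_def]
  by (rule measurable_compose_countable[OF copy_measurable impulses_before_measurable])

context
  fixes \<omega> assumes regular: "regular \<omega>"
begin

lemma after_impulse_inside:
  assumes "\<tau> (Suc i) \<omega> = grid n"
  shows "X (real n * h) (\<omega> (Suc (Suc i))) = \<psi> (X (real n * h) (\<omega> (Suc i)))"
    and "X (real n * h) (\<omega> (Suc (Suc i))) \<in> D"
    and "grid n < \<tau> (Suc (Suc i)) \<omega>"
proof -
  show *: "X (real n * h) (\<omega> (Suc (Suc i))) = \<psi> (X (real n * h) (\<omega> (Suc i)))"
    using regular assms unfolding regular_def by blast
  show **: "X (real n * h) (\<omega> (Suc (Suc i))) \<in> D"
    unfolding * using impulse_time_outside[OF assms] \<psi>_D by auto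
  show "grid n < \<tau> (Suc (Suc i)) \<omega>"
    unfolding grid_less_impulse_time_iff assms using ** by (auto simp: le_antisym)
qed

lemma grid_Suc_le_iff: "grid (Suc n) \<le> \<tau> i \<omega> \<longleftrightarrow> grid n < \<tau> i \<omega>"
  using impulse_times_grid[of i \<omega>] by (auto simp: Suc_le_eq ennreal_less_top simp del: of_nat_Suc)

text \<open>
  By induction along the grid: the copy in use before time \<open>n * h\<close> was activated before (strictly,
  unless it is the first one) and has not been replaced yet. It is replaced at time \<open>n * h\<close> exactly if
  it is outside \<open>D\<close>, and then its successor starts in \<open>D\<close> and is not replaced at once.
\<close>

lemma impulses_before_times:
  shows "(impulses_before n \<omega> = 0 \<or> \<tau> (impulses_before n \<omega>) \<omega> < grid n) \<and>
      \<tau> (impulses_before n \<omega>) \<omega> \<le> grid n \<and> grid n \<le> \<tau> (Suc (impulses_before n \<omega>)) \<omega>" (is "?before n")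
    and "\<tau> (impulses_before (Suc n) \<omega>) \<omega> \<le> grid n \<and> grid n < \<tau> (Suc (impulses_before (Suc n) \<omega>)) \<omega>" (is "?after n")
proof -
  have step: "?after n \<and> (state_before n \<omega> \<notin> D \<longrightarrow> \<tau> (Suc (impulses_before n \<omega>)) \<omega> = grid n)" if "?before n" for n
  proof (cases "state_before n \<omega> \<in> D")
    case True
    \<comment> \<open>At time \<open>n * h\<close> this is the case assumption, earlier it holds as the next impulse comes no sooner than \<open>n * h\<close>.\<close>
    have "X (real m * h) (\<omega> (Suc (impulses_before n \<omega>))) \<in> D"
      if "m \<le> n" "\<tau> (impulses_before n \<omega>) \<omega> \<le> grid m" for m
    proof (cases "m = n")
      case False
      with \<open>m \<le> n\<close> have "grid m < grid n" by simp
      also have "\<dots> \<le> \<tau> (Suc (impulses_before n \<omega>)) \<omega>" using \<open>?before n\<close> by blast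
      finally show ?thesis using that(2) unfolding grid_less_impulse_time_iff by blast
    qed (use True in \<open>simp add: state_before_def\<close>)
    then have "grid n < \<tau> (Suc (impulses_before n \<omega>)) \<omega>"
      unfolding grid_less_impulse_time_iff by blast
    with True that show ?thesis
      by (simp add: state_before_def del: impulse_times.simps)
  next
    case False
    have "\<tau> (Suc (impulses_before n \<omega>)) \<omega> \<le> grid n"
      using that False by (subst impulse_time_le_iff) (auto simp: state_before_def)
    with that have eq: "\<tau> (Suc (impulses_before n \<omega>)) \<omega> = grid n"
      by (intro antisym) blast+
    with after_impulse_inside(3)[OF eq] False show ?thesis
      by (simp add: state_before_def del: impulse_times.simps)
  qed
  show before: "?before n"
  proof (induction n)
    case (Suc n)
    have "grid n < grid (Suc n)" unfolding grid_less_iff by simp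
    with step[OF Suc] show ?case
      unfolding grid_Suc_le_iff by (auto simp del: impulses_before.simps impulse_times.simps)
  qed simp
  show "?after n"
    using step[OF before] by blast
qed

lemma copy_in_use_unique:
  assumes "\<tau> i \<omega> \<le> grid n" "grid n < \<tau> (Suc i) \<omega>"
  shows "i = impulses_before (Suc n) \<omega>"
proof (rule ccontr)
  assume "i \<noteq> impulses_before (Suc n) \<omega>"
  then consider "Suc i \<le> impulses_before (Suc n) \<omega>" | "Suc (impulses_before (Suc n) \<omega>) \<le> i"
    by linarith
  then show False
    using impulses_before_times(2)[of n] assms impulse_times_mono
    by cases (meson leD le_less_trans order_trans)+
qed

lemma impulse_at_iff:
  "\<tau> (Suc i) \<omega> = grid n \<longleftrightarrow> i = impulses_before n \<omega> \<and> state_before n \<omega> \<notin> D"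
proof
  assume at: "\<tau> (Suc i) \<omega> = grid n"
  from after_impulse_inside(3)[OF at] at have "Suc i = impulses_before (Suc n) \<omega>"
    by (intro copy_in_use_unique) auto
  moreover have "Suc i \<noteq> impulses_before n \<omega>"
    using impulses_before_times(1)[of n] at by force
  ultimately show "i = impulses_before n \<omega> \<and> state_before n \<omega> \<notin> D"
    by (auto simp: state_before_def split: if_splits)
next
  assume *: "i = impulses_before n \<omega> \<and> state_before n \<omega> \<notin> D"
  then have "impulses_before (Suc n) \<omega> = Suc i"
    by (simp add: state_before_def)
  with impulses_before_times[of n] * show "\<tau> (Suc i) \<omega> = grid n"
    by (intro antisym) (auto simp del: impulse_times.simps impulses_before.simps)
qed

lemma state_after_eq:
  "state_after n \<omega> = (if state_before n \<omega> \<in> D then state_before n \<omega> else \<psi> (state_before n \<omega>))"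
proof (cases "state_before n \<omega> \<in> D")
  case False
  then have "\<tau> (Suc (impulses_before n \<omega>)) \<omega> = grid n"
    by (simp add: impulse_at_iff del: impulse_times.simps)
  from after_impulse_inside(1)[OF this] False show ?thesis
    by (simp add: state_after_def state_before_def)
qed (simp add: state_after_def state_before_def)

lemma state_after_inside: "state_after n \<omega> \<in> D"
  unfolding state_after_eq using \<psi>_D by auto

lemma controlled_process_eq:
  "controlled_process X (induced_strategy X h D \<psi> \<xi>\<^sub>0) (real n * h) \<omega> = state_after n \<omega>"
proof -
  have "(THE i. 1 \<le> i \<and> \<tau> (i - 1) \<omega> \<le> grid n \<and> grid n < \<tau> i \<omega>) = Suc (impulses_before (Suc n) \<omega>)"
  proof (rule the_equality)
    fix i assume i: "1 \<le> i \<and> \<tau> (i - 1) \<omega> \<le> grid n \<and> grid n < \<tau> i \<omega>"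
    then obtain j where j: "i = Suc j" by (cases i) auto
    with i show "i = Suc (impulses_before (Suc n) \<omega>)"
      using copy_in_use_unique[of j n] by simp
  qed (use impulses_before_times(2)[of n] in \<open>simp del: impulse_times.simps impulses_before.simps\<close>)
  then show ?thesis
    by (simp add: controlled_process_def induced_strategy_def state_after_def)
qed

text \<open>
  Decomposes the event that copy \<open>Suc i\<close> is in use just after time \<open>n * h\<close> according to the time
  \<open>k * h\<close> at which it came into use. The law of the controlled system speaks about each part.
\<close>

lemma indicator_on_copy:
  assumes "\<omega> \<in> space M"
  shows "(\<Sum>k\<le>n. indicator (on_copy i k (Suc (n - k))) \<omega>) =
    (indicator {impulses_before (Suc n) \<omega>} i :: ennreal)"
proof (cases "\<tau> i \<omega> \<le> grid n \<and> grid n < \<tau> (Suc i) \<omega>")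
  case True
  then obtain k where k: "\<tau> i \<omega> = grid k" "k \<le> n"
    using impulse_times_grid[of i \<omega>] by (auto simp: top_unique)
  have "indicator (on_copy i k' (Suc (n - k'))) \<omega> = (if k' = k then 1 else 0 :: ennreal)" if "k' \<le> n" for k'
    using True k that assms unfolding grid_less_impulse_time_iff
    by (auto simp: on_copy_def indicator_def simp del: of_nat_add)
  then have "(\<Sum>k\<le>n. indicator (on_copy i k (Suc (n - k))) \<omega>) = (\<Sum>k'\<le>n. if k' = k then 1 else 0 :: ennreal)"
    by (intro sum.cong) auto
  also have "\<dots> = 1" using k by simp
  finally show ?thesis
    using copy_in_use_unique[of i n] True by simp
next
  case False
  have "\<omega> \<notin> on_copy i k (Suc (n - k))" if "k \<le> n" for k
  proof
    assume *: "\<omega> \<in> on_copy i k (Suc (n - k))"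
    then have at: "\<tau> i \<omega> = grid k"
      by (simp add: on_copy_def)
    have "X (real m * h) (\<omega> (Suc i)) \<in> D" if "k \<le> m" "m \<le> n" for m
    proof -
      have "m - k < Suc (n - k)" "k + (m - k) = m" using that by auto
      with * show ?thesis unfolding on_copy_def by (metis (mono_tags, lifting) mem_Collect_eq)
    qed
    then have "grid n < \<tau> (Suc i) \<omega>"
      unfolding grid_less_impulse_time_iff at by simp
    with at that False show False by simp
  qed
  moreover have "i \<noteq> impulses_before (Suc n) \<omega>"
    using False impulses_before_times(2)[of n] by blast
  ultimately show ?thesis by simp
qed

end

end

context controlled_grid
begin

lemma expectation_over_copies:
  fixes f :: "nat \<Rightarrow> (nat \<Rightarrow> 'w) \<Rightarrow> ennreal"
  assumes [measurable]: "\<And>i. f i \<in> borel_measurable M"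
  shows "(\<integral>\<^sup>+\<omega>. f (impulses_before (Suc n) \<omega>) \<omega> \<partial>M) =
    (\<Sum>i. \<Sum>k\<le>n. \<integral>\<^sup>+\<omega>. indicator (on_copy i k (Suc (n - k))) \<omega> * f i \<omega> \<partial>M)"
proof -
  have "AE \<omega> in M. f (impulses_before (Suc n) \<omega>) \<omega> =
      (\<Sum>i. \<Sum>k\<le>n. indicator (on_copy i k (Suc (n - k))) \<omega> * f i \<omega>)"
    using AE_regular AE_space
  proof eventually_elim
    case (elim \<omega>)
    have "(\<Sum>i. \<Sum>k\<le>n. indicator (on_copy i k (Suc (n - k))) \<omega> * f i \<omega>) =
        (\<Sum>i. indicator {impulses_before (Suc n) \<omega>} i * f i \<omega>)"
      by (simp only: sum_distrib_right[symmetric] indicator_on_copy[OF elim])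
    also have "\<dots> = (\<Sum>i\<in>{impulses_before (Suc n) \<omega>}. indicator {impulses_before (Suc n) \<omega>} i * f i \<omega>)"
      by (rule suminf_finite) (auto simp del: impulses_before.simps)
    finally show ?case
      by (simp del: impulses_before.simps)
  qed
  then have "(\<integral>\<^sup>+\<omega>. f (impulses_before (Suc n) \<omega>) \<omega> \<partial>M) =
      (\<integral>\<^sup>+\<omega>. (\<Sum>i. \<Sum>k\<le>n. indicator (on_copy i k (Suc (n - k))) \<omega> * f i \<omega>) \<partial>M)"
    by (rule nn_integral_cong_AE)
  also have "\<dots> = (\<Sum>i. \<integral>\<^sup>+\<omega>. (\<Sum>k\<le>n. indicator (on_copy i k (Suc (n - k))) \<omega> * f i \<omega>) \<partial>M)"
    by (intro nn_integral_suminf) measurable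
  also have "\<dots> = (\<Sum>i. \<Sum>k\<le>n. \<integral>\<^sup>+\<omega>. indicator (on_copy i k (Suc (n - k))) \<omega> * f i \<omega> \<partial>M)"
    by (intro suminf_cong nn_integral_sum) measurable
  finally show ?thesis .
qed

text \<open>
  Between two grid times the controlled chain moves like the uncontrolled one. This combines
  \<open>copy_Markov\<close> over all copies and all times at which they may have come into use.
\<close>

lemma Markov_between_impulses:
  assumes f: "f \<in> borel_measurable borel"
  shows "(\<integral>\<^sup>+\<omega>. f (state_before (Suc n) \<omega>) \<partial>M) = (\<integral>\<^sup>+\<omega>. step f (state_after n \<omega>) \<partial>M)"
proof -
  have "(\<integral>\<^sup>+\<omega>. indicator (on_copy i k (Suc (n - k))) \<omega> * f (X (real (Suc n) * h) (\<omega> (Suc i))) \<partial>M) =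
    (\<integral>\<^sup>+\<omega>. indicator (on_copy i k (Suc (n - k))) \<omega> * step f (X (real n * h) (\<omega> (Suc i))) \<partial>M)"
    if "k \<le> n" for i k
  proof -
    have "k + Suc (n - k) = Suc n" "k + (n - k) = n" using that by auto
    with copy_Markov[OF f, of i k "n - k"] show ?thesis by metis
  qed
  then have "(\<Sum>i. \<Sum>k\<le>n. \<integral>\<^sup>+\<omega>. indicator (on_copy i k (Suc (n - k))) \<omega> * f (X (real (Suc n) * h) (\<omega> (Suc i))) \<partial>M) =
    (\<Sum>i. \<Sum>k\<le>n. \<integral>\<^sup>+\<omega>. indicator (on_copy i k (Suc (n - k))) \<omega> * step f (X (real n * h) (\<omega> (Suc i))) \<partial>M)"
    by (intro suminf_cong sum.cong) auto
  then show ?thesis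
    unfolding state_before_def state_after_def
    using expectation_over_copies[where n=n and f="\<lambda>i \<omega>. f (X (real (Suc n) * h) (\<omega> (Suc i)))",
        OF measurable_compose[OF copy_measurable f]]
      expectation_over_copies[where n=n and f="\<lambda>i \<omega>. step f (X (real n * h) (\<omega> (Suc i)))",
        OF measurable_compose[OF copy_measurable step_measurable[OF f]]]
    by simp
qed

text \<open>
  The process agrees with \<open>state_after\<close> almost surely, but the Bochner integral in the cost functional
  also requires it to be measurable. The impulse times are weakly increasing everywhere, so that the
  definite description has at most one candidate; where it has none, it picks a fixed index, possibly
  the index \<open>0\<close>, whose component is constant.
\<close>

lemma controlled_process_measurable:
  "controlled_process X (induced_strategy X h D \<psi> \<xi>\<^sub>0) (real n * h) \<in> borel_measurable M"
proof -
  have copy: "(\<lambda>\<omega>. X (real n * h) (\<omega> i)) \<in> borel_measurable M" for i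
  proof (cases i)
    case 0
    have "X (real n * h) (\<omega> i) = X (real n * h) undefined" if "\<omega> \<in> space M" for \<omega>
      using that 0 by (auto simp: space_M copies_def space_PiM PiE_def extensional_def)
    then show ?thesis
      by (subst measurable_cong[where g="\<lambda>\<omega>. X (real n * h) undefined"]) auto
  next
    case (Suc j)
    then show ?thesis using copy_measurable by simp
  qed
  have unique: "i = j" if "1 \<le> i \<and> \<tau> (i - 1) \<omega> \<le> grid n \<and> grid n < \<tau> i \<omega>"
    "1 \<le> j \<and> \<tau> (j - 1) \<omega> \<le> grid n \<and> grid n < \<tau> j \<omega>" for i j \<omega>
  proof (rule ccontr)
    assume "i \<noteq> j"
    then consider "i \<le> j - 1" | "j \<le> i - 1" by linarith
    then show False
      using impulse_times_mono[of i "j - 1" \<omega>] impulse_times_mono[of j "i - 1" \<omega>] that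
      by cases (meson leD order_trans)+
  qed
  have pred: "Measurable.pred M (\<lambda>\<omega>. 1 \<le> i \<and> \<tau> (i - 1) \<omega> \<le> grid n \<and> grid n < \<tau> i \<omega>)" for i
    unfolding not_le[symmetric]
    by (intro pred_intros_logic(2,3) impulse_le_measurable) simp
  have "(\<lambda>\<omega>. THE i. 1 \<le> i \<and> \<tau> (i - 1) \<omega> \<le> grid n \<and> grid n < \<tau> i \<omega>) \<in> M \<rightarrow>\<^sub>M count_space UNIV"
    by (rule measurable_THE[where I=UNIV, OF pred _ _ unique]) (rule countableI_type UNIV_I)+
  from measurable_compose_countable[OF copy this] show ?thesis
    by (simp add: controlled_process_def[abs_def] induced_strategy_def)
qed

text \<open>
  Sorting the impulses by their times: on regular outcomes a grid time carries at most one impulse,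
  and it carries one iff the state before it is outside \<open>D\<close>.
\<close>

lemma impulse_costs_eq:
  assumes "regular \<omega>"
  shows "impulse_costs X c h a (induced_strategy X h D \<psi> \<xi>\<^sub>0) n \<omega> =
    (\<Sum>k\<le>n. if state_before k \<omega> \<in> D then 0
       else ennreal (1 / h * a k * c (state_before k \<omega>) (\<psi> (state_before k \<omega>))))"
proof -
  define v where "v k = ennreal (1 / h * a k * c (state_before k \<omega>) (\<psi> (state_before k \<omega>)))" for k
  have each_impulse: "(let i = Suc i; s = enn2real (\<tau> i \<omega>) in
       if \<tau> i \<omega> \<le> grid n
       then ennreal (1 / h * a (nat \<lfloor>s / h\<rfloor>) * c (X s (\<omega> i)) (X s (\<omega> (i + 1))))
       else 0) = (\<Sum>k\<le>n. if \<tau> (Suc i) \<omega> = grid k then v k else 0)" for i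
  proof (cases "\<tau> (Suc i) \<omega> \<le> grid n")
    case True
    then obtain k where k: "\<tau> (Suc i) \<omega> = grid k" "k \<le> n"
      using impulse_times_grid[of "Suc i" \<omega>] by (auto simp: top_unique simp del: impulse_times.simps)
    have "(\<Sum>k'\<le>n. if \<tau> (Suc i) \<omega> = grid k' then v k' else 0) = (\<Sum>k'\<le>n. if k' = k then v k' else 0)"
      unfolding k(1) by (intro sum.cong) auto
    also have "\<dots> = v k" using k(2) by simp
    also have "v k = ennreal (1 / h * a k * c (X (real k * h) (\<omega> (Suc i))) (X (real k * h) (\<omega> (Suc (Suc i)))))"
      using k(1) after_impulse_inside(1)[OF assms k(1)] impulse_at_iff[OF assms, of i k]
      by (simp add: v_def state_before_def del: impulse_times.simps)
    finally show ?thesis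
      using True k(1) h by (simp add: Let_def del: impulse_times.simps)
  next
    case False
    then have "\<tau> (Suc i) \<omega> \<noteq> grid k" if "k \<le> n" for k
      using that by auto
    then show ?thesis
      using False by (simp del: impulse_times.simps)
  qed
  have "impulse_costs X c h a (induced_strategy X h D \<psi> \<xi>\<^sub>0) n \<omega> =
      (\<Sum>i. \<Sum>k\<le>n. if \<tau> (Suc i) \<omega> = grid k then v k else 0)"
    unfolding impulse_costs_def induced_strategy_def prod.case each_impulse ..
  also have "\<dots> = (\<Sum>k\<le>n. \<Sum>i. if \<tau> (Suc i) \<omega> = grid k then v k else 0)"
    by (rule suminf_sum) auto
  also have "\<dots> = (\<Sum>k\<le>n. if state_before k \<omega> \<in> D then 0 else v k)"
  proof (intro sum.cong refl)
    fix k
    have "(\<Sum>i. if \<tau> (Suc i) \<omega> = grid k then v k else 0) =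
        (\<Sum>i\<in>{impulses_before k \<omega>}. if \<tau> (Suc i) \<omega> = grid k then v k else 0)"
      unfolding impulse_at_iff[OF assms] by (rule suminf_finite) auto
    then show "(\<Sum>i. if \<tau> (Suc i) \<omega> = grid k then v k else 0) = (if state_before k \<omega> \<in> D then 0 else v k)"
      unfolding impulse_at_iff[OF assms] by simp
  qed
  finally show ?thesis
    unfolding v_def .
qed

end

section \<open>The Poisson equation\<close>

text \<open>
  The Poisson equation reduced to a single step of the chain inside \<open>D\<close> and a single impulse outside.
\<close>

locale Poisson_solution = controlled_grid F X P U h D \<psi> \<xi>\<^sub>0 x M
  for F :: "ennreal \<Rightarrow> 'w measure"
    and X :: "real \<Rightarrow> 'w \<Rightarrow> 'e::{metric_space, second_countable_topology}"
    and P U h D \<psi> \<xi>\<^sub>0 x M +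
  fixes g w :: "'e \<Rightarrow> real" and c :: "'e \<Rightarrow> 'e \<Rightarrow> real" and lam K :: real
  assumes g_measurable [measurable]: "g \<in> borel_measurable borel"
    and w_measurable [measurable]: "w \<in> borel_measurable borel"
    and outside_cost_measurable [measurable]: "(\<lambda>z. if z \<in> D then 0 else c z (\<psi> z)) \<in> borel_measurable borel"
    and g_bound: "\<And>z. \<bar>g z\<bar> \<le> K"
    and w_bound: "\<And>z. \<bar>w z\<bar> \<le> K"
    and cost_bound: "\<And>z. z \<notin> D \<Longrightarrow> 0 \<le> c z (\<psi> z) \<and> c z (\<psi> z) \<le> K"
    and inside_equation: "\<And>z. z \<in> D \<Longrightarrow> (\<integral>\<omega>. w (X h \<omega>) \<partial>P z) = w z - g z + lam"
    and outside_equation: "\<And>z. z \<notin> D \<Longrightarrow> w z = 1 / h * c z (\<psi> z) + w (\<psi> z)"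
begin

abbreviation V :: "('w, 'e) strategy" where
  "V \<equiv> induced_strategy X h D \<psi> \<xi>\<^sub>0"

definition cost :: "'e \<Rightarrow> real" where
  "cost z = 1 / h * (if z \<in> D then 0 else c z (\<psi> z))"

definition mean_running :: "nat \<Rightarrow> real" where
  "mean_running n = (\<integral>\<omega>. g (state_after n \<omega>) \<partial>M)"

definition mean_cost :: "nat \<Rightarrow> real" where
  "mean_cost n = (\<integral>\<omega>. cost (state_before n \<omega>) \<partial>M)"

definition mean_potential :: "nat \<Rightarrow> real" where
  "mean_potential n = (\<integral>\<omega>. w (state_after n \<omega>) \<partial>M)"

lemma K_nonneg: "0 \<le> K"
  using g_bound[of undefined] by linarith

lemma cost_measurable [measurable]: "cost \<in> borel_measurable borel"
  unfolding cost_def[abs_def] by measurable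

lemma cost_nonneg: "0 \<le> cost z"
  using cost_bound[of z] h by (auto simp: cost_def)

lemma cost_le: "cost z \<le> K / h"
  using cost_bound[of z] h K_nonneg by (auto simp: cost_def divide_right_mono)

lemma integrable_g: "integrable M (\<lambda>\<omega>. g (state_after n \<omega>))"
  using g_bound by (intro integrable_const_bound[where B=K]) auto

lemma integrable_w: "integrable M (\<lambda>\<omega>. w (state_after n \<omega>))"
  using w_bound by (intro integrable_const_bound[where B=K]) auto

lemma integrable_w_before: "integrable M (\<lambda>\<omega>. w (state_before n \<omega>))"
  using w_bound by (intro integrable_const_bound[where B=K]) auto

lemma integrable_cost: "integrable M (\<lambda>\<omega>. cost (state_before n \<omega>))"
  using cost_nonneg cost_le by (intro integrable_const_bound[where B="K / h"]) auto

lemma mean_potential_bound: "\<bar>mean_potential n\<bar> \<le> K"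
proof -
  have "\<bar>mean_potential n\<bar> \<le> (\<integral>\<omega>. \<bar>w (state_after n \<omega>)\<bar> \<partial>M)"
    unfolding mean_potential_def by (rule integral_abs_bound)
  also have "\<dots> \<le> (\<integral>\<omega>. K \<partial>M)"
    using integrable_w w_bound by (intro integral_mono) auto
  finally show ?thesis by (simp add: prob_space)
qed

lemma mean_running_bound: "\<bar>mean_running n\<bar> \<le> K"
proof -
  have "\<bar>mean_running n\<bar> \<le> (\<integral>\<omega>. \<bar>g (state_after n \<omega>)\<bar> \<partial>M)"
    unfolding mean_running_def by (rule integral_abs_bound)
  also have "\<dots> \<le> (\<integral>\<omega>. K \<partial>M)"
    using integrable_g g_bound by (intro integral_mono) auto
  finally show ?thesis by (simp add: prob_space)
qed

lemma mean_cost_nonneg: "0 \<le> mean_cost n"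
  unfolding mean_cost_def by (intro integral_nonneg_AE) (simp add: cost_nonneg)

lemma mean_cost_le: "mean_cost n \<le> K / h"
proof -
  have "mean_cost n \<le> (\<integral>\<omega>. K / h \<partial>M)"
    unfolding mean_cost_def using integrable_cost cost_le by (intro integral_mono) auto
  then show ?thesis by (simp add: prob_space)
qed

text \<open>
  Inside \<open>D\<close>, where the state after an impulse opportunity always is, the Poisson equation makes
  \<open>w\<close> of the next state before impulses equal in mean to \<open>w - g + lam\<close>; the impulse relation then splits
  \<open>w\<close> of that state into the impulse cost and \<open>w\<close> of the state after the impulse.
\<close>

lemma mean_balance: "mean_running n + mean_cost (Suc n) = lam + mean_potential n - mean_potential (Suc n)"
proof -
  have shift: "0 \<le> w z + K" for z
    using w_bound[of z] by linarith
  have next_potential: "step (\<lambda>z. ennreal (w z + K)) z = ennreal (w z - g z + lam + K)"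
    "0 \<le> w z - g z + lam + K" if "z \<in> D" for z
  proof -
    interpret P: prob_space "P z" by (rule prob_space_P)
    have [measurable]: "X h \<in> borel_measurable (P z)"
      using h by (auto intro: X_measurable_P)
    have int: "integrable (P z) (\<lambda>\<omega>. w (X h \<omega>))"
      using w_bound by (intro P.integrable_const_bound[where B=K]) auto
    have eq: "(\<integral>\<omega>. w (X h \<omega>) + K \<partial>P z) = w z - g z + lam + K"
      using int by (simp add: inside_equation[OF that] P.prob_space)
    have "step (\<lambda>z. ennreal (w z + K)) z = ennreal (\<integral>\<omega>. w (X h \<omega>) + K \<partial>P z)"
      unfolding step_def using int shift by (intro nn_integral_eq_integral) auto
    then show "step (\<lambda>z. ennreal (w z + K)) z = ennreal (w z - g z + lam + K)"
      unfolding eq .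
    show "0 \<le> w z - g z + lam + K"
      unfolding eq[symmetric] using shift by (intro integral_nonneg_AE AE_I2) simp
  qed
  have inside: "AE \<omega> in M. state_after n \<omega> \<in> D"
    using AE_regular by eventually_elim (rule state_after_inside)
  \<comment> \<open>The shift by \<open>K\<close> makes \<open>w\<close> nonnegative, as the Markov property is available for nonnegative integrals.\<close>
  have "(\<integral>\<omega>. w (state_before (Suc n) \<omega>) + K \<partial>M) = enn2real (\<integral>\<^sup>+\<omega>. ennreal (w (state_before (Suc n) \<omega>) + K) \<partial>M)"
    using shift by (intro integral_eq_nn_integral AE_I2) auto
  also have "\<dots> = enn2real (\<integral>\<^sup>+\<omega>. step (\<lambda>z. ennreal (w z + K)) (state_after n \<omega>) \<partial>M)"
    by (subst Markov_between_impulses) auto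
  also have "\<dots> = enn2real (\<integral>\<^sup>+\<omega>. ennreal (w (state_after n \<omega>) - g (state_after n \<omega>) + lam + K) \<partial>M)"
    using inside by (intro arg_cong[where f=enn2real] nn_integral_cong_AE) (auto simp: next_potential(1))
  also have "\<dots> = (\<integral>\<omega>. w (state_after n \<omega>) - g (state_after n \<omega>) + lam + K \<partial>M)"
    using inside next_potential(2) by (intro integral_eq_nn_integral[symmetric]) auto
  finally have Markov: "(\<integral>\<omega>. w (state_before (Suc n) \<omega>) \<partial>M) = mean_potential n - mean_running n + lam"
    using integrable_w[of n] integrable_g[of n] integrable_w_before[of "Suc n"]
    by (simp add: prob_space mean_potential_def mean_running_def)
  have "AE \<omega> in M. w (state_before (Suc n) \<omega>) = cost (state_before (Suc n) \<omega>) + w (state_after (Suc n) \<omega>)"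
    using AE_regular by eventually_elim (auto simp: state_after_eq cost_def outside_equation)
  then have "(\<integral>\<omega>. w (state_before (Suc n) \<omega>) \<partial>M) =
      (\<integral>\<omega>. cost (state_before (Suc n) \<omega>) + w (state_after (Suc n) \<omega>) \<partial>M)"
    by (intro integral_cong_AE) measurable
  also have "\<dots> = mean_cost (Suc n) + mean_potential (Suc n)"
    using integrable_w[of "Suc n"] integrable_cost[of "Suc n"]
    by (simp add: mean_cost_def mean_potential_def)
  finally show ?thesis
    using Markov by simp
qed

lemma expected_running:
  assumes "finite I"
  shows "(\<integral>\<omega>. (\<Sum>i\<in>I. \<phi> i * g (controlled_process X V (real i * h) \<omega>)) \<partial>M) = (\<Sum>i\<in>I. \<phi> i * mean_running i)"
proof -
  note [measurable] = controlled_process_measurable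
  have "AE \<omega> in M. (\<Sum>i\<in>I. \<phi> i * g (controlled_process X V (real i * h) \<omega>)) = (\<Sum>i\<in>I. \<phi> i * g (state_after i \<omega>))"
    using AE_regular by eventually_elim (simp add: controlled_process_eq)
  then have "(\<integral>\<omega>. (\<Sum>i\<in>I. \<phi> i * g (controlled_process X V (real i * h) \<omega>)) \<partial>M) =
      (\<integral>\<omega>. (\<Sum>i\<in>I. \<phi> i * g (state_after i \<omega>)) \<partial>M)"
    by (intro integral_cong_AE) measurable
  also have "\<dots> = (\<Sum>i\<in>I. \<phi> i * mean_running i)"
    using integrable_g by (subst Bochner_Integration.integral_sum) (auto simp: mean_running_def)
  finally show ?thesis .
qed

lemma expected_impulse_costs:
  assumes \<phi>: "\<And>k. 0 \<le> \<phi> k"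
  shows "(\<integral>\<^sup>+\<omega>. impulse_costs X c h \<phi> V n \<omega> \<partial>M) = ennreal (\<Sum>k\<le>n. \<phi> k * mean_cost k)"
proof -
  have "AE \<omega> in M. impulse_costs X c h \<phi> V n \<omega> = ennreal (\<Sum>k\<le>n. \<phi> k * cost (state_before k \<omega>))"
    using AE_regular
  proof eventually_elim
    case (elim \<omega>)
    have "(if z \<in> D then 0 else ennreal (1 / h * \<phi> k * c z (\<psi> z))) = ennreal (\<phi> k * cost z)" for k z
      by (simp add: cost_def mult_ac)
    then show ?case
      unfolding impulse_costs_eq[OF elim] using \<phi> cost_nonneg by simp
  qed
  then have "(\<integral>\<^sup>+\<omega>. impulse_costs X c h \<phi> V n \<omega> \<partial>M) = (\<integral>\<^sup>+\<omega>. ennreal (\<Sum>k\<le>n. \<phi> k * cost (state_before k \<omega>)) \<partial>M)"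
    by (rule nn_integral_cong_AE)
  also have "\<dots> = ennreal (\<integral>\<omega>. (\<Sum>k\<le>n. \<phi> k * cost (state_before k \<omega>)) \<partial>M)"
    using \<phi> cost_nonneg integrable_cost by (intro nn_integral_eq_integral) (auto intro!: sum_nonneg)
  also have "(\<integral>\<omega>. (\<Sum>k\<le>n. \<phi> k * cost (state_before k \<omega>)) \<partial>M) = (\<Sum>k\<le>n. \<phi> k * mean_cost k)"
    using integrable_cost by (subst Bochner_Integration.integral_sum) (auto simp: mean_cost_def)
  finally show ?thesis .
qed

lemma weighted_cost_limit:
  fixes \<phi> :: "nat \<Rightarrow> real"
  assumes "\<And>i. \<phi> (Suc i) \<le> \<phi> i" "\<And>i. 0 \<le> \<phi> i"
    and "filterlim (\<lambda>n. \<Sum>i<n. \<phi> i) at_top sequentially"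
  shows "(\<lambda>n. ((\<Sum>i<n. \<phi> i * mean_running i) + (\<Sum>i\<le>n. \<phi> i * mean_cost i)) / (\<Sum>i<n. \<phi> i)) \<longlonglongrightarrow> lam"
  using assms mean_balance mean_potential_bound
proof (rule weighted_average_of_balanced)
  show "\<bar>mean_cost i\<bar> \<le> K / h" for i
    using mean_cost_nonneg[of i] mean_cost_le[of i] by simp
qed

text \<open>
  Constant weights, except that here the running costs are taken at the times \<open>1, \<dots>, n\<close> instead of
  \<open>0, \<dots>, n - 1\<close>; the difference of the two bounded terms vanishes after division by \<open>n\<close>.
\<close>

lemma averaged_cost_limit:
  "(\<lambda>n. ((\<Sum>i=1..n. mean_running i) + (\<Sum>i\<le>n. mean_cost i)) / real n) \<longlonglongrightarrow> lam"
proof -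
  have "(\<lambda>n. ((\<Sum>i<n. 1 * mean_running i) + (\<Sum>i\<le>n. 1 * mean_cost i)) / (\<Sum>i<n. 1)) \<longlonglongrightarrow> lam"
    by (rule weighted_cost_limit) (simp_all add: filterlim_real_sequentially)
  moreover have "(\<lambda>n. (mean_running n - mean_running 0) / real n) \<longlonglongrightarrow> 0"
  proof (rule Lim_null_comparison)
    have "\<bar>mean_running n - mean_running 0\<bar> \<le> 2 * K" for n
      using mean_running_bound[of n] mean_running_bound[of 0] by linarith
    then show "\<forall>\<^sub>F n in sequentially. norm ((mean_running n - mean_running 0) / real n) \<le> 2 * K / real n"
      by (auto intro!: always_eventually divide_right_mono)
    show "(\<lambda>n. 2 * K / real n) \<longlonglongrightarrow> 0"
      by (rule real_tendsto_divide_at_top[OF tendsto_const filterlim_real_sequentially])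
  qed
  ultimately have "(\<lambda>n. ((\<Sum>i<n. 1 * mean_running i) + (\<Sum>i\<le>n. 1 * mean_cost i)) / (\<Sum>i<n. 1)
      + (mean_running n - mean_running 0) / real n) \<longlonglongrightarrow> lam + 0"
    by (rule tendsto_add)
  moreover have "((\<Sum>i<n. 1 * mean_running i) + (\<Sum>i\<le>n. 1 * mean_cost i)) / (\<Sum>i<n. 1)
      + (mean_running n - mean_running 0) / real n
      = ((\<Sum>i=1..n. mean_running i) + (\<Sum>i\<le>n. mean_cost i)) / real n" for n
  proof -
    have "(\<Sum>i=1..n. mean_running i) = (\<Sum>i<n. mean_running i) + (mean_running n - mean_running 0)"
      by (induction n) simp_all
    then show ?thesis
      by (simp add: add_divide_distrib diff_divide_distrib)
  qed
  ultimately show ?thesis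
    by simp
qed

lemma J_disc_eq:
  assumes M: "Q x V = M"
    and \<beta>: "\<And>t. 0 \<le> t \<Longrightarrow> 0 < \<beta> t \<and> \<beta> t \<le> 1" "\<And>s t. 0 \<le> s \<Longrightarrow> s \<le> t \<Longrightarrow> \<beta> t \<le> \<beta> s" "continuous_on {0..} \<beta>"
    and \<beta>_integral: "(\<integral>\<^sup>+s\<in>{0..}. ennreal (\<beta> s) \<partial>lborel) = \<infinity>"
  shows "J_disc X Q \<beta> g c h x V = ereal lam"
proof -
  define \<phi> where "\<phi> = discount_weight \<beta> h"
  have pos: "0 < \<phi> i" for i
    unfolding \<phi>_def by (rule discount_weight_pos[OF \<beta> h])
  have nonneg: "0 \<le> \<phi> i" for i
    using pos[of i] by simp
  have lim: "(\<lambda>n. ((\<Sum>i<n. \<phi> i * mean_running i) + (\<Sum>i\<le>n. \<phi> i * mean_cost i)) / (\<Sum>i<n. \<phi> i)) \<longlonglongrightarrow> lam"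
    using discount_weight_decreasing[OF \<beta> h] discount_weights_divergent[OF \<beta> h \<beta>_integral] nonneg
    unfolding \<phi>_def by (intro weighted_cost_limit) auto
  have "\<forall>\<^sub>F n in sequentially.
      ereal (((\<Sum>i<n. \<phi> i * mean_running i) + (\<Sum>i\<le>n. \<phi> i * mean_cost i)) / (\<Sum>i<n. \<phi> i)) =
      (ereal (\<integral>\<omega>. (\<Sum>i<n. \<phi> i * g (controlled_process X V (real i * h) \<omega>)) \<partial>Q x V)
        + enn2ereal (\<integral>\<^sup>+\<omega>. impulse_costs X c h \<phi> V n \<omega> \<partial>Q x V)) / ereal (\<Sum>i<n. \<phi> i)"
    using eventually_gt_at_top[of 0]
  proof eventually_elim
    case (elim n)
    have "0 < (\<Sum>i<n. \<phi> i)"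
      using elim pos by (intro sum_pos) auto
    moreover have "0 \<le> (\<Sum>k\<le>n. \<phi> k * mean_cost k)"
      using nonneg mean_cost_nonneg by (intro sum_nonneg mult_nonneg_nonneg) auto
    ultimately show ?case
      unfolding M expected_impulse_costs[of \<phi>, OF nonneg] expected_running[OF finite_lessThan]
      by (simp add: enn2ereal_ennreal)
  qed
  moreover from lim have "(\<lambda>n. ereal (((\<Sum>i<n. \<phi> i * mean_running i) + (\<Sum>i\<le>n. \<phi> i * mean_cost i))
      / (\<Sum>i<n. \<phi> i))) \<longlonglongrightarrow> ereal lam"
    by (rule tendsto_ereal)
  ultimately show ?thesis
    unfolding J_disc_def \<phi>_def[symmetric]
    by (intro lim_imp_Limsup[OF sequentially_bot]) (rule Lim_transform_eventually)
qed

lemma J_avg_eq: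
  assumes M: "Q x V = M"
  shows "J_avg X Q g c h x V = ereal lam"
proof -
  have "\<forall>\<^sub>F n in sequentially.
      ereal (((\<Sum>i=1..n. mean_running i) + (\<Sum>i\<le>n. mean_cost i)) / real n) =
      (ereal (\<integral>\<omega>. (\<Sum>i=1..n. g (controlled_process X V (real i * h) \<omega>)) \<partial>Q x V)
        + enn2ereal (\<integral>\<^sup>+\<omega>. impulse_costs X c h (\<lambda>_. 1) V n \<omega> \<partial>Q x V)) / ereal (real n)"
    using eventually_gt_at_top[of 0]
  proof eventually_elim
    case (elim n)
    have "0 \<le> (\<Sum>k\<le>n. mean_cost k)"
      using mean_cost_nonneg by (intro sum_nonneg) auto
    with elim show ?case
      unfolding M
      using expected_impulse_costs[of "\<lambda>_. 1" n] expected_running[of "{1..n}" "\<lambda>_. 1"]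
      by (simp add: enn2ereal_ennreal)
  qed
  moreover from averaged_cost_limit have "(\<lambda>n. ereal (((\<Sum>i=1..n. mean_running i) + (\<Sum>i\<le>n. mean_cost i))
      / real n)) \<longlonglongrightarrow> ereal lam"
    by (rule tendsto_ereal)
  ultimately show ?thesis
    unfolding J_avg_def
    by (intro lim_imp_Limsup[OF sequentially_bot]) (rule Lim_transform_eventually)
qed

end

theorem theorem3p10:
  fixes F :: "ennreal \<Rightarrow> 'w measure"
    and X :: "real \<Rightarrow> 'w \<Rightarrow> 'e::{metric_space, second_countable_topology}"
    and P :: "'e \<Rightarrow> 'w measure"
    and U :: "'e set"
    and Q :: "'e \<Rightarrow> ('w, 'e) strategy \<Rightarrow> (nat \<Rightarrow> 'w) measure"
    and \<beta> :: "real \<Rightarrow> real"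
    and g :: "'e \<Rightarrow> real"
    and c :: "'e \<Rightarrow> 'e \<Rightarrow> real"
    and c\<^sub>0 h lam :: real
    and D :: "'e set"
    and \<psi> :: "'e \<Rightarrow> 'e"
    and \<xi>\<^sub>0 :: 'e
    and w :: "'e \<Rightarrow> real"
  assumes process: "standard_process F X P"
    and U: "compact U" "U \<noteq> {}"
    and beta_range: "\<And>t. 0 \<le> t \<Longrightarrow> 0 < \<beta> t \<and> \<beta> t \<le> 1"
    and beta_decreasing: "\<And>s t. 0 \<le> s \<Longrightarrow> s \<le> t \<Longrightarrow> \<beta> t \<le> \<beta> s"
    and beta_continuous: "continuous_on {0..} \<beta>"
    and beta_0: "\<beta> 0 = 1"
    and beta_mult: "\<And>s t. 0 \<le> s \<Longrightarrow> 0 \<le> t \<Longrightarrow> \<beta> t * \<beta> s \<le> \<beta> (t + s)"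
    and beta_integral: "(\<integral>\<^sup>+s\<in>{0..}. ennreal (\<beta> s) \<partial>lborel) = \<infinity>"
    and g: "continuous_on UNIV g" "bounded (range g)"
    and c: "continuous_on (UNIV \<times> U) (\<lambda>(x, \<xi>). c x \<xi>)" "bounded ((\<lambda>(x, \<xi>). c x \<xi>) ` (UNIV \<times> U))"
    and c_lower: "0 < c\<^sub>0" "\<And>x \<xi>. \<xi> \<in> U \<Longrightarrow> c\<^sub>0 \<le> c x \<xi>"
    and c_triangle: "\<And>x \<xi> \<eta>. \<xi> \<in> U \<Longrightarrow> \<eta> \<in> U \<Longrightarrow> c x \<xi> \<le> c x \<eta> + c \<eta> \<xi>"
    and Feller: "\<And>f t. continuous_on UNIV f \<Longrightarrow> bounded (range f) \<Longrightarrow> 0 < t \<Longrightarrow>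
      continuous_on UNIV (\<lambda>x. \<integral>\<omega>. f (X t \<omega>) \<partial>P x) \<and>
      bounded (range (\<lambda>x. \<integral>\<omega>. (f (X t \<omega>) :: real) \<partial>P x))"
    and ergodic: "\<And>t. 0 < t \<Longrightarrow> \<exists>\<Lambda>. 0 < \<Lambda> \<and> \<Lambda> < 1 \<and> (\<forall>x y. \<forall>A\<in>sets borel.
      \<bar>measure (P x) {\<omega>\<in>space (P x). X t \<omega> \<in> A} - measure (P y) {\<omega>\<in>space (P y). X t \<omega> \<in> A}\<bar> \<le> \<Lambda>)"
    and law: "\<And>x V. V \<in> strategies F U \<Longrightarrow> controlled_law F X P x V (Q x V)"
    and h: "0 < h"
    and D: "D \<in> sets borel"
    and psi: "\<psi> \<in> borel_measurable (restrict_space borel (- D))" "bounded (\<psi> ` (- D))"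
      "\<psi> ` (- D) \<subseteq> U" "\<psi> ` (- D) \<subseteq> D"
    and xi0: "\<xi>\<^sub>0 \<in> U"
    and w: "w \<in> borel_measurable borel" "bounded (range w)"
    and Poisson: "\<And>n x. w x =
      (\<integral>\<omega>. (\<Sum>i\<in>{i. i < n \<and> ennreal (real i * h) < exit_time X h D \<omega>}. (g (X (real i * h) \<omega>) - lam))
            + w (X (enn2real (min (ennreal (real n * h)) (exit_time X h D \<omega>))) \<omega>) \<partial>P x)"
    and Poisson_impulse: "\<And>x. x \<notin> D \<Longrightarrow> w x = 1 / h * c x (\<psi> x) + w (\<psi> x)"
  shows "induced_strategy X h D \<psi> \<xi>\<^sub>0 \<in> grid_strategies F U h \<and>
    (\<forall>x. J_disc X Q \<beta> g c h x (induced_strategy X h D \<psi> \<xi>\<^sub>0) = ereal lam \<and>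
         ereal lam = J_avg X Q g c h x (induced_strategy X h D \<psi> \<xi>\<^sub>0))"
proof -
  interpret standard_process F X P by (rule process)
  interpret grid_impulses F X P U h D \<psi> \<xi>\<^sub>0
    by unfold_locales (fact h D psi xi0)+
  have admissible: "induced_strategy X h D \<psi> \<xi>\<^sub>0 \<in> grid_strategies F U h"
    by (rule induced_strategy_admissible)
  then have strategy: "induced_strategy X h D \<psi> \<xi>\<^sub>0 \<in> strategies F U"
    by (auto simp: grid_strategies_def)
  have g_measurable: "g \<in> borel_measurable borel"
    using g(1) by (rule borel_measurable_continuous_onI)
  \<comment> \<open>The cost is continuous on \<open>UNIV \<times> U\<close> only, so the impulse map is extended with values in \<open>U\<close>.\<close>
  define \<psi>' where "\<psi>' z = (if z \<in> D then \<xi>\<^sub>0 else \<psi> z)" for z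
  have \<psi>'_U: "\<psi>' z \<in> U" for z
    using psi(3) xi0 by (auto simp: \<psi>'_def)
  have \<psi>'_measurable: "\<psi>' \<in> borel_measurable borel"
    unfolding \<psi>'_def[abs_def] by (rule \<psi>_extended_measurable) simp
  have "(\<lambda>z. (z, \<psi>' z)) \<in> borel \<rightarrow>\<^sub>M restrict_space borel (UNIV \<times> U)"
    using \<psi>'_U \<psi>'_measurable by (intro measurable_restrict_space2 borel_measurable_Pair) auto
  from measurable_compose[OF this borel_measurable_continuous_on_restrict[OF c(1)]]
  have [measurable]: "(\<lambda>z. c z (\<psi>' z)) \<in> borel_measurable borel"
    by simp
  have "(\<lambda>z. if z \<in> D then 0 else c z (\<psi>' z)) \<in> borel_measurable borel"
    using D by measurable
  also have "(\<lambda>z. if z \<in> D then 0 else c z (\<psi>' z)) = (\<lambda>z. if z \<in> D then 0 else c z (\<psi> z))"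
    by (auto simp: \<psi>'_def)
  finally have cost_measurable: "(\<lambda>z. if z \<in> D then 0 else c z (\<psi> z)) \<in> borel_measurable borel" .
  obtain K1 where K1: "\<bar>g z\<bar> \<le> K1" for z
    using g(2) by (auto simp: bounded_iff)
  obtain K2 where K2: "\<bar>w z\<bar> \<le> K2" for z
    using w(2) by (auto simp: bounded_iff)
  obtain K3 where K3: "\<bar>c z \<xi>\<bar> \<le> K3" if "\<xi> \<in> U" for z \<xi>
    using c(2) by (auto simp: bounded_iff)
  define K where "K = max K1 (max K2 K3)"
  have solution: "Poisson_solution F X P U h D \<psi> \<xi>\<^sub>0 x (Q x (induced_strategy X h D \<psi> \<xi>\<^sub>0)) g w c lam K" for x
  proof (intro_locales, unfold controlled_grid_axioms_def Poisson_solution_axioms_def, safe)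
    show "controlled_law F X P x (induced_strategy X h D \<psi> \<xi>\<^sub>0) (Q x (induced_strategy X h D \<psi> \<xi>\<^sub>0))"
      by (rule law[OF strategy])
    show "\<bar>g z\<bar> \<le> K" "\<bar>w z\<bar> \<le> K" for z
      using K1[of z] K2[of z] by (auto simp: K_def)
    fix z
    show "0 \<le> c z (\<psi> z)" "c z (\<psi> z) \<le> K" if "z \<notin> D"
    proof -
      have "\<psi> z \<in> U" using that psi(3) by auto
      then show "0 \<le> c z (\<psi> z)" "c z (\<psi> z) \<le> K"
        using c_lower(1) c_lower(2)[of "\<psi> z" z] K3[of "\<psi> z" z] by (auto simp: K_def)
    qed
    show "(\<integral>\<omega>. w (X h \<omega>) \<partial>P z) = w z - g z + lam" if "z \<in> D"
      by (rule one_step_Poisson[OF w(1) g_measurable w(2) Poisson[of z 1] that])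
    show "w z = 1 / h * c z (\<psi> z) + w (\<psi> z)" if "z \<notin> D"
      by (rule Poisson_impulse[OF that])
  qed (fact g_measurable w(1) cost_measurable)+
  have "J_disc X Q \<beta> g c h x (induced_strategy X h D \<psi> \<xi>\<^sub>0) = ereal lam" for x
    by (intro Poisson_solution.J_disc_eq[where Q = Q and \<beta> = \<beta>, OF solution] refl
        beta_range beta_decreasing beta_continuous beta_integral)
  moreover have "J_avg X Q g c h x (induced_strategy X h D \<psi> \<xi>\<^sub>0) = ereal lam" for x
    by (intro Poisson_solution.J_avg_eq[where Q = Q, OF solution] refl)
  ultimately show ?thesis
    using admissible by simp
qed

end
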